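(* Let $\gamma$ and $\Gamma$ be ellipses in $\mathbb{R}^2$ with $\gamma$ contained in the interior of $\Gamma$, and let $n \ge 3$. Suppose the pair $(\gamma,\Gamma)$ admits a one-parameter family $\{P_t\}$ of Poncelet $n$-gons (closed $n$-gons inscribed in $\Gamma$ and circumscribed about $\gamma$), obtained by letting the initial vertex range over $\Gamma$. Then each of the two loci $\{CM_0(P_t)\}$ and $\{CM_2(P_t)\}$ is either an ellipse homothetic to $\Gamma$ or a single point.
   Context: A Poncelet $n$-gon for the pair $(\gamma,\Gamma)$ is a polygon $P=(A_1,\dots,A_n)$ with all vertices on $\Gamma$, each side $A_iA_{i+1}$ (indices mod $n$) tangent to $\gamma$, and with consecutive sides being the two distinct tangent lines from $A_{i+1}$ to $\gamma$, so that after $n$ steps of the construction "from $A_i$ draw the other tangent line to $\gamma$ and let $A_{i+1}$ be its second intersection with $\Gamma$" one returns to $A_1$. Writing $A_i=(x_i,y_i)$ and $d_i = x_i y_{i+1} - x_{i+1} y_i$ (indices mod $n$), and $A(P)=\tfrac12\sum_{i=1}^n d_i$ (signed area), define the vertex centroid $CM_0(P)=\frac1n\sum_{i=1}^n (x_i,y_i)$ and the lamina centroid $CM_2(P)=\frac{1}{6A(P)}\sum_{i=1}^n d_i\,(x_i+x_{i+1},\,y_i+y_{i+1})$ (for an embedded polygon this is the centroid of the polygon as a homogeneous region). An ellipse is homothetic to $\Gamma$ if it is the image of $\Gamma$ under a map $z\mapsto \lambda z + c$ with $\lambda>0$, $c\in\mathbb{R}^2$. *)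

theory Defs
  imports "HOL-Analysis.Analysis"
begin

type_synonym pt = "real \<times> real"

text \<open>An ellipse: image of the unit circle under an invertible affine map of the plane.\<close>
definition ellipse :: "pt set \<Rightarrow> bool" where
  "ellipse E \<longleftrightarrow> (\<exists>c1 c2 a b c d. a * d - b * c \<noteq> 0 \<and>
      E = {(c1 + a * cos t + b * sin t, c2 + c * cos t + d * sin t) | t. True})"

definition line_through :: "pt \<Rightarrow> pt \<Rightarrow> pt set" where
  "line_through p q = {p + t *\<^sub>R (q - p) | t. True}"

definition tangent_to :: "pt set \<Rightarrow> pt set \<Rightarrow> bool" where
  "tangent_to L g \<longleftrightarrow> (\<exists>!x. x \<in> L \<and> x \<in> g)"

definition poncelet_ngon :: "pt set \<Rightarrow> pt set \<Rightarrow> nat \<Rightarrow> (nat \<Rightarrow> pt) \<Rightarrow> bool" where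
  "poncelet_ngon g G n A \<longleftrightarrow>
     (\<forall>i<n. A i \<in> G) \<and>
     (\<forall>i<n. A i \<noteq> A (Suc i mod n) \<and> tangent_to (line_through (A i) (A (Suc i mod n))) g) \<and>
     (\<forall>i<n. line_through (A i) (A (Suc i mod n)) \<noteq>
             line_through (A (Suc i mod n)) (A (Suc (Suc i) mod n)))"

definition CM0 :: "nat \<Rightarrow> (nat \<Rightarrow> pt) \<Rightarrow> pt" where
  "CM0 n A = (1 / real n) *\<^sub>R (\<Sum>i<n. A i)"

definition dd :: "nat \<Rightarrow> (nat \<Rightarrow> pt) \<Rightarrow> nat \<Rightarrow> real" where
  "dd n A i = fst (A i) * snd (A (Suc i mod n)) - fst (A (Suc i mod n)) * snd (A i)"

definition signed_area :: "nat \<Rightarrow> (nat \<Rightarrow> pt) \<Rightarrow> real" where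
  "signed_area n A = (1/2) * (\<Sum>i<n. dd n A i)"

definition CM2 :: "nat \<Rightarrow> (nat \<Rightarrow> pt) \<Rightarrow> pt" where
  "CM2 n A = (1 / (6 * signed_area n A)) *\<^sub>R (\<Sum>i<n. dd n A i *\<^sub>R (A i + A (Suc i mod n)))"

definition homothetic_to :: "pt set \<Rightarrow> pt set \<Rightarrow> bool" where
  "homothetic_to E G \<longleftrightarrow> (\<exists>(lam::real) c. lam > 0 \<and> E = (\<lambda>z. lam *\<^sub>R z + c) ` G)"

end

theory Submission
  imports Defs "HOL-Computational_Algebra.Polynomial"
begin

text \<open>An affine map makes the inner ellipse the unit circle and the outer one the image of the unit
  circle under \<open>\<phi> z = c + p z + q cnj z\<close>; Poncelet's map becomes a map \<open>T\<close> of the unit circle. With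
  \<open>t(z)\<close> the tangent length from \<open>\<phi> z\<close> to the inner circle, \<open>d\<theta> / t\<close> is \<open>T\<close>-invariant.

  By Darboux's argument, the orbit polynomials \<open>\<Prod>(X - T\<^sup>i z)\<close> lie in a pencil, because the Bezoutian of
  two of them vanishes on more tangent lines of the inner conic than its degree allows. Comparing
  coefficients, the vertex sum is an affine function \<open>\<alpha> + \<beta> u\<close> of the vertex product \<open>u\<close>, which lies on
  the unit circle and attains every value there since it has no critical point. This gives the vertex
  centroid.

  The triangles from the centre of the inner circle to the sides have height 1, so the lamina centroid
  is one third of the mean of the vertices \<open>\<phi> (T\<^sup>i z)\<close> with weights \<open>t(T\<^sup>i z)\<close>. Differentiating
  \<open>\<Sum> T\<^sup>i z = \<alpha> + \<beta> u\<close> along the flow of the invariant measure gives \<open>\<Sum> t(T\<^sup>i z) T\<^sup>i z = \<beta> u \<Sum> t(T\<^sup>i z)\<close>,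
  so this mean is \<open>\<phi> (\<beta> u)\<close>.\<close>

section \<open>Tangent chords of the unit circle\<close>

text \<open>In affine coordinates that make the inner ellipse the unit circle, the outer one is its
  image under \<open>c + p * z + q * cnj z\<close>. Every real affine map of the plane has this
  form, with determinant \<open>(cmod p)^2 - (cmod q)^2\<close>; \<open>inside\<close> puts the unit
  circle inside the outer ellipse.\<close>

locale poncelet_pair =
  fixes c p q :: complex
  assumes nondegenerate: "cmod p \<noteq> cmod q"
    and inside: "cmod S = 1 \<Longrightarrow> \<exists>y. cmod y < 1 \<and> c + p * y + q * cnj y = S"
begin

definition phi :: "complex \<Rightarrow> complex" where
  "phi z = c + p * z + q * cnj z"

definition tlen :: "complex \<Rightarrow> real" where
  "tlen z = sqrt ((cmod (phi z))\<^sup>2 - 1)"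

text \<open>The tangent at a unit vector \<open>S\<close> consists of the points
  \<open>S * (1 + i * x)\<close> with \<open>x\<close> real. Of the two contact points of tangents
  from \<open>phi z\<close>, this one puts \<open>phi z\<close> at \<open>x = - tlen z\<close>,
  which fixes the sense of rotation of \<open>step\<close>.\<close>

definition foot :: "complex \<Rightarrow> complex" where
  "foot z = phi z / (1 - \<i> * tlen z)"

text \<open>By Vieta, the product of the two roots of \<open>chord_poly (foot z)\<close> divided by
  the known root \<open>z\<close>.\<close>

definition step :: "complex \<Rightarrow> complex" where
  "step z = (q + cnj p * (foot z)\<^sup>2) / ((p + cnj q * (foot z)\<^sup>2) * z)"

lemma phi_linear_eq_0: "p * d + q * cnj d = 0 \<Longrightarrow> d = 0"
  by (metis add_eq_0_iff complex_mod_cnj mult_cancel_right nondegenerate norm_eq_zero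
      norm_minus_cancel norm_mult)

lemma phi_inj: "phi z = phi w \<Longrightarrow> z = w"
  using phi_linear_eq_0[of "z - w"] by (simp add: phi_def algebra_simps)

lemma inside_phi: "cmod S = 1 \<Longrightarrow> \<exists>y. cmod y < 1 \<and> phi y = S"
  using inside unfolding phi_def by blast

lemma phi_convex:
  "phi (of_real (1 - s) * y1 + of_real s * y2) = of_real (1 - s) * phi y1 + of_real s * phi y2"
  by (simp add: phi_def algebra_simps)

text \<open>A point \<open>phi z\<close> of the closed disc lies on a diameter whose ends are images
  of points of the open disc. As \<open>phi\<close> is injective and preserves convex combinations,
  \<open>z\<close> would lie in the open disc.\<close>

lemma phi_outside:
  assumes "cmod z = 1" shows "cmod (phi z) > 1"
proof (rule ccontr)
  assume "\<not> cmod (phi z) > 1"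
  then have le: "cmod (phi z) \<le> 1" by simp
  \<comment> \<open>Any direction serves when \<open>phi z = 0\<close>; 1 is the default.\<close>
  define S where "S = (if phi z = 0 then 1 else sgn (phi z))"
  have S1: "cmod S = 1" and S2: "phi z = cmod (phi z) * S"
    by (auto simp: S_def norm_sgn sgn_div_norm scaleR_conv_of_real norm_mult norm_inverse)
  obtain y1 where y1: "cmod y1 < 1" "phi y1 = S" using inside_phi[OF S1] by blast
  obtain y2 where y2: "cmod y2 < 1" "phi y2 = - S" using inside_phi[of "-S"] S1 by auto
  define s where "s = (1 - cmod (phi z)) / 2"
  have s: "0 \<le> s" "s < 1" using le norm_ge_zero[of "phi z"] by (auto simp: s_def intro: less_le_trans[of "-1" 0])
  have "phi (of_real (1 - s) * y1 + of_real s * y2) = of_real (1 - 2 * s) * S"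
    unfolding phi_convex y1 y2 by (simp add: algebra_simps)
  also have "\<dots> = phi z" using S2 by (simp add: s_def diff_divide_distrib)
  finally have "z = of_real (1 - s) * y1 + of_real s * y2" by (metis phi_inj)
  then have "cmod z \<le> (1 - s) * cmod y1 + s * cmod y2"
    using s norm_triangle_ineq[of "of_real (1 - s) * y1" "of_real s * y2"]
    by (simp add: norm_mult del: of_real_diff)
  also have "\<dots> < (1 - s) * 1 + s * 1"
    using s y1 y2 by (intro add_less_le_mono mult_strict_left_mono mult_left_mono) auto
  finally show False using assms by simp
qed

lemma tlen_pos: "cmod z = 1 \<Longrightarrow> tlen z > 0"
  using phi_outside[of z] by (simp add: tlen_def power2_eq_square less_1_mult)

lemma tlen_sq: "cmod z = 1 \<Longrightarrow> (cmod (phi z))\<^sup>2 = 1 + (tlen z)\<^sup>2"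
  using phi_outside[of z] by (simp add: tlen_def power2_eq_square less_imp_le less_1_mult)

lemma one_plus_i_nz: "1 + \<i> * of_real x \<noteq> 0" "1 - \<i> * of_real x \<noteq> 0"
  by (auto simp: complex_eq_iff)

lemma cmod_one_i_sq: "(cmod (1 + \<i> * of_real x))\<^sup>2 = 1 + x\<^sup>2" "(cmod (1 - \<i> * of_real x))\<^sup>2 = 1 + x\<^sup>2"
  by (simp_all add: cmod_power2)

lemma foot_norm:
  assumes "cmod z = 1" shows "cmod (foot z) = 1"
proof -
  have "(cmod (phi z))\<^sup>2 = (cmod (1 - \<i> * tlen z))\<^sup>2"
    by (simp only: tlen_sq[OF assms] cmod_one_i_sq)
  then have "cmod (phi z) = cmod (1 - \<i> * tlen z)" by simp
  moreover have "cmod (1 - \<i> * tlen z) \<noteq> 0" using one_plus_i_nz(2)[of "tlen z"] by simp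
  ultimately show ?thesis unfolding foot_def norm_divide by simp
qed

lemma phi_foot: "phi z = foot z * (1 - \<i> * tlen z)"
  using one_plus_i_nz(2)[of "tlen z"] by (simp add: foot_def)

lemma tangent_end_tlen:
  assumes "cmod z = 1" "cmod S = 1" "phi z = S * (1 + \<i> * of_real x)"
  shows "x\<^sup>2 = (tlen z)\<^sup>2"
proof -
  have "(cmod (phi z))\<^sup>2 = 1 + x\<^sup>2"
    using assms(2,3) by (simp only: norm_mult power_mult_distrib cmod_one_i_sq) simp
  then show ?thesis using tlen_sq[OF assms(1)] by simp
qed

lemma foot_unique:
  assumes "cmod z = 1" "cmod S = 1" "phi z = S * (1 + \<i> * of_real x)" "x < 0"
  shows "S = foot z" and "x = - tlen z"
proof -
  have "x\<^sup>2 = (tlen z)\<^sup>2" by (rule tangent_end_tlen[OF assms(1-3)])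
  then show x: "x = - tlen z" using assms(4) tlen_pos[OF assms(1)] by (auto simp: power2_eq_iff)
  show "S = foot z" using assms(3) one_plus_i_nz(2)[of "tlen z"] unfolding foot_def x by simp
qed

section \<open>The quadratic equation of a tangent chord\<close>

lemma lead_nz:
  assumes "cmod S = 1" shows "p + cnj q * S\<^sup>2 \<noteq> 0"
proof
  assume "p + cnj q * S\<^sup>2 = 0"
  then have "p = - (cnj q * S\<^sup>2)" by (simp add: add_eq_0_iff2)
  then have "cmod p = cmod q" using assms by (simp add: norm_mult norm_power)
  then show False using nondegenerate by simp
qed

text \<open>The point \<open>phi z\<close> lies on the tangent at \<open>S\<close> when
  \<open>Re (phi z * cnj S) = 1\<close>. Multiplying by \<open>2 * S * z\<close> and using
  \<open>cnj z = 1 / z\<close>, \<open>cnj S = 1 / S\<close> on the unit circle removes the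
  conjugates of both variables.\<close>

definition chord_poly :: "complex \<Rightarrow> complex \<Rightarrow> complex" where
  "chord_poly S z = (p + cnj q * S\<^sup>2) * z\<^sup>2 + (c + cnj c * S\<^sup>2 - 2 * S) * z + (q + cnj p * S\<^sup>2)"

lemma unit_mult_cnj: "cmod z = 1 \<Longrightarrow> z * cnj z = 1" "cmod z = 1 \<Longrightarrow> cnj z * z = 1"
  by (simp_all add: complex_norm_square[symmetric] mult.commute)

lemma chord_poly_eq:
  assumes "cmod z = 1" "cmod S = 1"
  shows "chord_poly S z = 2 * S * z * (Re (phi z * cnj S) - 1)"
proof -
  define r where "r = Re (phi z * cnj S)"
  have "2 * complex_of_real r = phi z * cnj S + cnj (phi z * cnj S)"
    unfolding r_def by (simp only: complex_add_cnj of_real_mult of_real_numeral)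
  then have "2 * S * z * (r - 1) = S * z * (phi z * cnj S + cnj (phi z * cnj S) - 2)"
    by (simp add: algebra_simps)
  also have "\<dots> = chord_poly S z"
    using unit_mult_cnj[OF assms(1)] unit_mult_cnj[OF assms(2)] unfolding chord_poly_def phi_def
    by (simp, algebra)
  finally show ?thesis by (simp add: r_def)
qed

lemma chord_poly_zero_iff:
  assumes "cmod z = 1" "cmod S = 1"
  shows "chord_poly S z = 0 \<longleftrightarrow> (\<exists>x::real. phi z = S * (1 + \<i> * x))"
proof -
  have nz: "S \<noteq> 0" "z \<noteq> 0" using assms by auto
  have "chord_poly S z = 0 \<longleftrightarrow> Re (phi z * cnj S) = 1"
  proof -
    have "complex_of_real r - 1 = 0 \<longleftrightarrow> r = 1" for r by (auto simp: complex_eq_iff)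
    then show ?thesis using nz by (simp add: chord_poly_eq[OF assms] del: times_complex.sel)
  qed
  also have "\<dots> \<longleftrightarrow> (\<exists>x::real. phi z * cnj S = 1 + \<i> * x)"
    by (auto simp: complex_eq_iff)
  also have "\<dots> \<longleftrightarrow> (\<exists>x::real. phi z = S * (1 + \<i> * x))"
  proof -
    have "phi z * cnj S = v \<longleftrightarrow> phi z = S * v" for v
      using unit_mult_cnj[OF assms(2)] by (metis mult.assoc mult.commute mult_1)
    then show ?thesis by simp
  qed
  finally show ?thesis .
qed

text \<open>The tangent at \<open>S\<close> pulls back under \<open>phi\<close> to the line
  \<open>Re (w * cnj y) = - h\<close>, at distance \<open>|h| / cmod w\<close> from 0. A vanishing
  discriminant would make this distance 1, but the line contains the preimage of \<open>S\<close>,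
  which lies in the open disc.\<close>

lemma discriminant_nz:
  assumes "cmod S = 1"
  shows "(c + cnj c * S\<^sup>2 - 2 * S)\<^sup>2 \<noteq> 4 * (p + cnj q * S\<^sup>2) * (q + cnj p * S\<^sup>2)"
proof
  assume eq: "(c + cnj c * S\<^sup>2 - 2 * S)\<^sup>2 = 4 * (p + cnj q * S\<^sup>2) * (q + cnj p * S\<^sup>2)"
  obtain y where y: "cmod y < 1" "phi y = S" using inside_phi[OF assms] by blast
  define h where "h = Re (c * cnj S) - 1"
  define w where "w = cnj p * S + q * cnj S"
  have u: "S * cnj S = 1" using unit_mult_cnj[OF assms] by simp
  have b: "c + cnj c * S\<^sup>2 - 2 * S = 2 * S * h"
  proof -
    have "2 * complex_of_real h = c * cnj S + cnj (c * cnj S) - 2"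
      unfolding h_def
      by (simp only: complex_add_cnj of_real_mult of_real_diff of_real_numeral of_real_1 right_diff_distrib) simp
    then have "2 * S * h = S * (c * cnj S + cnj c * S - 2)"
      by simp
    then show ?thesis using u by algebra
  qed
  have dp: "(p + cnj q * S\<^sup>2) * (q + cnj p * S\<^sup>2) = S\<^sup>2 * (w * cnj w)"
    using u by (simp add: w_def) algebra
  have "S\<^sup>2 * h\<^sup>2 = S\<^sup>2 * (w * cnj w)" using eq dp unfolding b of_real_power by algebra
  then have "complex_of_real (h\<^sup>2) = w * cnj w" using assms by auto
  then have "complex_of_real (h\<^sup>2) = of_real ((cmod w)\<^sup>2)" by (simp only: complex_norm_square)
  then have hw: "\<bar>h\<bar> = cmod w" by (simp only: of_real_eq_iff power2_eq_iff) auto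
  have wnz: "w \<noteq> 0"
  proof
    assume "w = 0"
    then have "(p + cnj q * S\<^sup>2) * (q + cnj p * S\<^sup>2) = 0" using dp by simp
    moreover have "q + cnj p * S\<^sup>2 = S\<^sup>2 * cnj (p + cnj q * S\<^sup>2)" using u by simp algebra
    ultimately have "S = 0 \<or> p + cnj q * S\<^sup>2 = 0"
      by (simp only: mult_eq_0_iff complex_cnj_zero_iff power_eq_0_iff) blast
    then show False using lead_nz[OF assms] assms by auto
  qed
  have "Re (w * cnj y) = Re (phi y * cnj S) - Re (c * cnj S)"
    by (simp add: w_def phi_def algebra_simps)
  also have "\<dots> = - h" using y u by (simp add: h_def)
  finally have "\<bar>h\<bar> \<le> cmod (w * cnj y)" by (metis abs_Re_le_cmod abs_minus_cancel)
  also have "\<dots> = cmod w * cmod y" by (simp add: norm_mult)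
  also have "\<dots> < cmod w * 1" using wnz y by (intro mult_strict_left_mono) auto
  finally show False using hw by simp
qed

text \<open>Vieta gives the second root. It has modulus 1 because the constant coefficient is
  \<open>S^2\<close> times the conjugate of the leading one, and it differs from \<open>z\<close>
  because the discriminant is nonzero.\<close>

lemma chord_roots:
  assumes "cmod z = 1" "cmod S = 1" "chord_poly S z = 0"
    and w: "w = (q + cnj p * S\<^sup>2) / ((p + cnj q * S\<^sup>2) * z)"
  shows "chord_poly S w = 0" "cmod w = 1" "w \<noteq> z"
    "(p + cnj q * S\<^sup>2) * (z + w) = - (c + cnj c * S\<^sup>2 - 2 * S)"
    "(p + cnj q * S\<^sup>2) * (z * w) = q + cnj p * S\<^sup>2"
    "\<And>v. chord_poly S v = 0 \<Longrightarrow> v = z \<or> v = w"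
proof -
  define D b E where "D = p + cnj q * S\<^sup>2" and "b = c + cnj c * S\<^sup>2 - 2 * S" and "E = q + cnj p * S\<^sup>2"
  have D: "D \<noteq> 0" using lead_nz[OF assms(2)] by (simp add: D_def)
  have z: "z \<noteq> 0" using assms by auto
  have K: "chord_poly S v = D * v\<^sup>2 + b * v + E" for v by (simp add: chord_poly_def D_def b_def E_def)
  have wp: "D * (z * w) = E" unfolding w using D z by (simp add: D_def E_def)
  have "z * (D * (z + w) + b) = 0" using assms(3) wp unfolding K by algebra
  then have ws: "D * (z + w) = - b" using z by (simp add: eq_neg_iff_add_eq_0)
  have fac: "chord_poly S v = D * (v - z) * (v - w)" for v
  proof -
    have "D * (v - z) * (v - w) = D * v\<^sup>2 - (D * (z + w)) * v + D * (z * w)"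
      by (simp add: algebra_simps power2_eq_square)
    then show ?thesis unfolding K wp ws by simp
  qed
  show "chord_poly S w = 0" by (simp add: fac)
  show "D * (z + w) = - b" "D * (z * w) = E" by (fact ws wp)+
  show "v = z \<or> v = w" if "chord_poly S v = 0" for v using that D by (simp add: fac)
  have "E = S\<^sup>2 * cnj D" using unit_mult_cnj[OF assms(2)] unfolding E_def D_def by simp algebra
  then have "cmod E = cmod D" using assms(2) by (simp add: norm_mult norm_power)
  then show "cmod w = 1" using wp D assms(1) by (metis mult_cancel_left1 norm_eq_zero norm_mult mult_1)
  show "w \<noteq> z"
  proof
    assume "w = z"
    then have "b = - (D * (2 * z))" "E = D * z\<^sup>2" using wp ws by (auto simp: power2_eq_square)
    then have "b\<^sup>2 = 4 * D * E" by (simp add: power2_eq_square)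
    then show False using discriminant_nz[OF assms(2)] by (simp add: D_def b_def E_def)
  qed
qed

lemma chord_poly_foot: "cmod z = 1 \<Longrightarrow> chord_poly (foot z) z = 0"
  using chord_poly_zero_iff[of z "foot z"] foot_norm[of z] phi_foot[of z]
  by (auto intro!: exI[of _ "- tlen z"])

lemma
  assumes "cmod z = 1"
  shows norm_step: "cmod (step z) = 1"
    and step_neq: "step z \<noteq> z"
    and chord_poly_step: "chord_poly (foot z) (step z) = 0"
    and step_sum: "(p + cnj q * (foot z)\<^sup>2) * (z + step z) = - (c + cnj c * (foot z)\<^sup>2 - 2 * foot z)"
    and step_prod: "(p + cnj q * (foot z)\<^sup>2) * (z * step z) = q + cnj p * (foot z)\<^sup>2"
    and chord_ends: "\<And>v. chord_poly (foot z) v = 0 \<Longrightarrow> v = z \<or> v = step z"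
  using chord_roots[OF assms foot_norm[OF assms] chord_poly_foot[OF assms] step_def] by blast+

section \<open>Orientation of tangent chords and injectivity of the Poncelet map\<close>

lemma segment_beyond:
  fixes y z w :: complex
  assumes "cmod y < 1" "cmod z = 1" "cmod w = 1" "w - y = of_real r * (z - y)" "r \<ge> 0"
  shows "w = z"
proof -
  have aux: "cmod (of_real (1 - s) * y + of_real s * z') < 1"
    if "0 \<le> s" "s < 1" "cmod z' = 1" for s and z' :: complex
  proof -
    have "cmod (of_real (1 - s) * y + of_real s * z') \<le> (1 - s) * cmod y + s * cmod z'"
      using that norm_triangle_ineq[of "of_real (1 - s) * y" "of_real s * z'"]
      by (simp add: norm_mult del: of_real_diff)
    also have "\<dots> < (1 - s) * 1 + s * 1"
      using that assms(1) by (intro add_less_le_mono mult_strict_left_mono mult_left_mono) auto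
    finally show ?thesis by simp
  qed
  consider "r < 1" | "r = 1" | "r > 1" by linarith
  then show ?thesis
  proof cases
    case 1
    have "w = of_real (1 - r) * y + of_real r * z" using assms(4) by (simp add: algebra_simps)
    then show ?thesis using aux[of r z] 1 assms by auto
  next
    case 2 then show ?thesis using assms(4) by simp
  next
    case 3
    have "z = of_real (1 - inverse r) * y + of_real (inverse r) * w"
      using 3 assms(4) by (simp add: field_simps)
    then show ?thesis using aux[of "inverse r" w] 3 assms by (auto simp: inverse_less_1_iff)
  qed
qed

text \<open>The contact point is inside the outer ellipse. Were both ends on the same side of it, a
  ray from its preimage in the open disc would meet the unit circle twice.\<close>

lemma tangent_ends_opposite:
  assumes "cmod z = 1" "cmod w = 1" "cmod S = 1" "z \<noteq> w"
    and z: "phi z = S * (1 + \<i> * of_real x)" and w: "phi w = S * (1 + \<i> * of_real x')"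
  shows "x * x' < 0"
proof (rule ccontr)
  assume neg: "\<not> x * x' < 0"
  obtain y where y: "cmod y < 1" "phi y = S" using inside_phi assms by blast
  have x: "x \<noteq> 0" using phi_outside[OF assms(1)] assms(3) z by auto
  have "p * (x * (w - y) - x' * (z - y)) + q * cnj (x * (w - y) - x' * (z - y))
       = x * (phi w - phi y) - x' * (phi z - phi y)"
    by (simp add: phi_def algebra_simps)
  also have "\<dots> = 0" unfolding w z y(2) by (simp add: algebra_simps)
  finally have "x * (w - y) - x' * (z - y) = 0" by (rule phi_linear_eq_0)
  then have "w - y = of_real (x' / x) * (z - y)" using x by (simp add: field_simps)
  moreover have "x' / x \<ge> 0" using neg by (simp add: zero_le_divide_iff mult_less_0_iff) linarith
  ultimately show False using segment_beyond[OF y(1) assms(1,2)] assms(4) by metis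
qed

lemma phi_step:
  assumes "cmod z = 1"
  shows "phi (step z) = foot z * (1 + \<i> * tlen (step z))"
proof -
  let ?S = "foot z" and ?w = "step z"
  have w: "cmod ?w = 1" "?w \<noteq> z" using norm_step step_neq assms by auto
  obtain x where x: "phi ?w = ?S * (1 + \<i> * of_real x)"
    using chord_poly_zero_iff[OF w(1) foot_norm[OF assms]] chord_poly_step[OF assms] by blast
  have "phi z = ?S * (1 + \<i> * of_real (- tlen z))" using phi_foot[of z] by simp
  then have "- tlen z * x < 0"
    using tangent_ends_opposite[OF assms w(1) foot_norm[OF assms] w(2)[symmetric] _ x] by blast
  then have "x > 0" using tlen_pos[OF assms] by (simp add: zero_less_mult_iff)
  then have "x = tlen ?w"
    using tangent_end_tlen[OF w(1) foot_norm[OF assms] x] tlen_pos[OF w(1)] by (auto simp: power2_eq_iff)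
  then show ?thesis using x by simp
qed

text \<open>For an unoriented chord, the end with negative parameter is the one whose
  \<open>foot\<close> is \<open>S\<close>, and \<open>step\<close> takes it to the other
  end.\<close>

lemma tangent_chord_step:
  assumes "cmod z = 1" "cmod w = 1" "cmod S = 1" "z \<noteq> w"
    and z: "phi z = S * (1 + \<i> * of_real x)" and w: "phi w = S * (1 + \<i> * of_real x')"
  shows "w = step z \<or> z = step w"
proof -
  have 0: "chord_poly S z = 0" "chord_poly S w = 0" using chord_poly_zero_iff assms by blast+
  consider "x < 0" | "x' < 0"
    using tangent_ends_opposite[OF assms] by (auto simp: mult_less_0_iff)
  then show ?thesis
  proof cases
    case 1
    then have "S = foot z" using foot_unique assms by blast
    then show ?thesis using chord_ends[OF assms(1)] 0 assms(4) by blast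
  next
    case 2
    then have "S = foot w" using foot_unique assms by blast
    then show ?thesis using chord_ends[OF assms(2)] 0 assms(4) by blast
  qed
qed

text \<open>Otherwise \<open>w\<close> is the far end of the chord from \<open>z\<close>, and
  \<open>phi w\<close> has both parameters \<open>tlen w\<close> and \<open>- tlen w\<close> on one
  tangent.\<close>

lemma foot_inj:
  assumes "cmod z = 1" "cmod w = 1" "foot z = foot w" shows "z = w"
proof (rule ccontr)
  assume "z \<noteq> w"
  then have "w = step z" using chord_ends[OF assms(1), of w] chord_poly_foot[OF assms(2)] assms(3) by auto
  then have "foot w * (1 - \<i> * tlen w) = foot w * (1 + \<i> * tlen w)"
    using phi_step[OF assms(1)] phi_foot[of w] assms(3) by simp
  moreover have "foot w \<noteq> 0" using foot_norm[OF assms(2)] by auto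
  ultimately show False using tlen_pos[OF assms(2)] by (simp add: complex_eq_iff)
qed

lemma step_inj:
  assumes "cmod z = 1" "cmod w = 1" "step z = step w" shows "z = w"
proof -
  have "foot z = foot w"
    using phi_step[OF assms(1)] phi_step[OF assms(2)] assms(3) one_plus_i_nz(1)
    by (metis mult_cancel_right)
  then show ?thesis using foot_inj assms by blast
qed

text \<open>If \<open>step\<close> swapped \<open>z\<close> and \<open>w\<close>, each of
  \<open>phi z\<close> and \<open>phi w\<close> would be given by both contact points with opposite
  signs; crosswise multiplication yields \<open>s + t = 0\<close>, against positive tangent
  lengths.\<close>

lemma step_step_neq:
  assumes "cmod z = 1" shows "step (step z) \<noteq> z"
proof
  let ?w = "step z"
  assume a: "step ?w = z"
  have w: "cmod ?w = 1" using norm_step assms by auto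
  define s t S R where "s = tlen z" and "t = tlen ?w" and "S = foot z" and "R = foot ?w"
  have "S * (1 - \<i> * s) = R * (1 + \<i> * s)" "S * (1 + \<i> * t) = R * (1 - \<i> * t)"
    using phi_step[OF assms] phi_step[OF w] phi_foot[of z] phi_foot[of ?w] a
    by (auto simp: s_def t_def S_def R_def)
  then have "S * R * ((1 - \<i> * s) * (1 - \<i> * t)) = S * R * ((1 + \<i> * s) * (1 + \<i> * t))" by algebra
  moreover have "S * R \<noteq> 0" using foot_norm[OF assms] foot_norm[OF w] by (auto simp: S_def R_def)
  ultimately have "(1 - \<i> * s) * (1 - \<i> * t) = (1 + \<i> * s) * (1 + \<i> * t)" by simp
  then have "s + t = 0" by (auto simp: complex_eq_iff algebra_simps)
  then show False using tlen_pos[OF assms] tlen_pos[OF w] by (simp add: s_def t_def)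
qed

end

section \<open>The invariant measure of the Poncelet map\<close>

lemma cnj_has_vector_derivative:
  "(f has_vector_derivative f') F \<Longrightarrow> ((\<lambda>x. cnj (f x)) has_vector_derivative cnj f') F"
  by (rule bounded_linear.has_vector_derivative[OF bounded_linear_cnj])

context poncelet_pair begin

text \<open>Provides only the existence of the derivatives, so that \<open>chord_poly\<close> may
  later be differentiated implicitly. The square root in \<open>tlen\<close> is differentiable
  because \<open>phi z\<close> is strictly outside the unit circle.\<close>

lemma step_differentiable:
  fixes \<zeta> :: "real \<Rightarrow> complex"
  assumes unit: "\<And>x. cmod (\<zeta> x) = 1" and d: "\<zeta> differentiable (at a)"
  shows "(\<lambda>x. foot (\<zeta> x)) differentiable (at a)" "(\<lambda>x. step (\<zeta> x)) differentiable (at a)"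
proof -
  obtain \<zeta>' where \<zeta>': "(\<zeta> has_vector_derivative \<zeta>') (at a)"
    using d by (auto simp: vector_derivative_works)
  have cnj_diff: "(\<lambda>x. cnj (f x)) differentiable (at a)" if "f differentiable (at a)" for f :: "real \<Rightarrow> complex"
    using that cnj_has_vector_derivative differentiableI_vector vector_derivative_works by metis
  have phi: "(\<lambda>x. phi (\<zeta> x)) differentiable (at a)"
    unfolding phi_def by (intro differentiable_add differentiable_mult differentiable_const d cnj_diff)
  have "tlen (\<zeta> x) = sqrt (Re (phi (\<zeta> x)) ^ 2 + Im (phi (\<zeta> x)) ^ 2 - 1)" for x
    by (simp add: tlen_def cmod_power2)
  moreover have "(\<lambda>x. sqrt (Re (phi (\<zeta> x)) ^ 2 + Im (phi (\<zeta> x)) ^ 2 - 1)) differentiable (at a)"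
  proof -
    obtain D where D: "((\<lambda>x. phi (\<zeta> x)) has_vector_derivative D) (at a)"
      using phi by (auto simp: vector_derivative_works)
    have "((\<lambda>x. Re (phi (\<zeta> x))) has_vector_derivative Re D) (at a)"
         "((\<lambda>x. Im (phi (\<zeta> x))) has_vector_derivative Im D) (at a)"
      by (auto intro!: bounded_linear.has_vector_derivative[OF bounded_linear_Re]
          bounded_linear.has_vector_derivative[OF bounded_linear_Im] D)
    then have ReIm: "((\<lambda>x. Re (phi (\<zeta> x))) has_real_derivative Re D) (at a)"
         "((\<lambda>x. Im (phi (\<zeta> x))) has_real_derivative Im D) (at a)"
      by (simp_all add: has_real_derivative_iff_has_vector_derivative)
    have pos: "0 < (Re (phi (\<zeta> a)))\<^sup>2 + (Im (phi (\<zeta> a)))\<^sup>2 - 1"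
      using tlen_pos[OF unit[of a]] by (simp add: tlen_def cmod_power2)
    have "((\<lambda>x. Re (phi (\<zeta> x)) ^ 2 + Im (phi (\<zeta> x)) ^ 2 - 1) has_real_derivative
        2 * Re (phi (\<zeta> a)) * Re D + 2 * Im (phi (\<zeta> a)) * Im D) (at a)"
      by (rule derivative_eq_intros ReIm refl)+ simp
    from DERIV_chain2[OF DERIV_real_sqrt[OF pos] this]
    show ?thesis using real_differentiable_def by blast
  qed
  ultimately have tl: "(\<lambda>x. tlen (\<zeta> x)) differentiable (at a)" by simp
  have tl': "(\<lambda>x. complex_of_real (tlen (\<zeta> x))) differentiable (at a)"
  proof -
    obtain D where "((\<lambda>x. tlen (\<zeta> x)) has_vector_derivative D) (at a)"
      using tl by (auto simp: vector_derivative_works)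
    from bounded_linear.has_vector_derivative[OF bounded_linear_of_real this]
    show ?thesis by (rule differentiableI_vector)
  qed
  show foot: "(\<lambda>x. foot (\<zeta> x)) differentiable (at a)"
    unfolding foot_def
    by (intro differentiable_divide phi differentiable_diff differentiable_mult differentiable_const tl'
        one_plus_i_nz)
  show "(\<lambda>x. step (\<zeta> x)) differentiable (at a)"
    unfolding step_def
    using lead_nz[OF foot_norm[OF unit[of a]]] unit[of a]
    by (intro differentiable_divide differentiable_add differentiable_mult differentiable_power
        differentiable_const foot d) auto
qed

lemma chord_poly_deriv:
  assumes "(S has_vector_derivative S') (at a)" "(z has_vector_derivative z') (at a)"
  shows "((\<lambda>x. chord_poly (S x) (z x)) has_vector_derivative
     (2 * cnj q * S a * (z a)\<^sup>2 + (2 * cnj c * S a - 2) * z a + 2 * cnj p * S a) * S' +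
     (2 * (p + cnj q * (S a)\<^sup>2) * z a + (c + cnj c * (S a)\<^sup>2 - 2 * S a)) * z') (at a)"
  unfolding chord_poly_def power2_eq_square
  by (rule derivative_eq_intros assms refl)+ (simp add: algebra_simps)

lemma chord_poly_partial_foot:
  assumes "cmod z = 1" "cmod S = 1" "phi z = S * (1 + \<i> * of_real x)"
  shows "2 * cnj q * S * z\<^sup>2 + (2 * cnj c * S - 2) * z + 2 * cnj p * S = - 2 * \<i> * x * z"
proof -
  have u: "z * cnj z = 1" "S * cnj S = 1" using unit_mult_cnj assms by auto
  have "cnj (phi z) * S = 1 - \<i> * x"
    using u unfolding assms(3) by simp algebra
  moreover have "2 * cnj q * S * z\<^sup>2 + (2 * cnj c * S - 2) * z + 2 * cnj p * S
      = 2 * z * (cnj (phi z) * S - 1)"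
    unfolding phi_def using u by simp algebra
  ultimately show ?thesis by simp
qed

text \<open>Along the flow with angular speed \<^term>\<open>tlen\<close>, the two ends of a moving tangent chord
  turn at the rates prescribed at each end: this is the invariant measure of Poncelet's map.\<close>

lemma step_has_vector_derivative:
  fixes \<zeta> :: "real \<Rightarrow> complex"
  assumes unit: "\<And>x. cmod (\<zeta> x) = 1"
    and d: "(\<zeta> has_vector_derivative \<i> * \<zeta> a * tlen (\<zeta> a) * k) (at a)"
  shows "((\<lambda>x. step (\<zeta> x)) has_vector_derivative \<i> * step (\<zeta> a) * tlen (step (\<zeta> a)) * k) (at a)"
proof -
  have diff: "\<zeta> differentiable (at a)" using d by (rule differentiableI_vector)
  obtain S' where S': "((\<lambda>x. foot (\<zeta> x)) has_vector_derivative S') (at a)"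
    using step_differentiable(1)[OF unit diff] by (auto simp: vector_derivative_works)
  obtain w' where w': "((\<lambda>x. step (\<zeta> x)) has_vector_derivative w') (at a)"
    using step_differentiable(2)[OF unit diff] by (auto simp: vector_derivative_works)
  define z w S t r where "z = \<zeta> a" and "w = step (\<zeta> a)" and "S = foot (\<zeta> a)"
    and "t = tlen (\<zeta> a)" and "r = tlen (step (\<zeta> a))"
  define D where "D = p + cnj q * S\<^sup>2"
  define b where "b = c + cnj c * S\<^sup>2 - 2 * S"
  have n: "cmod z = 1" "cmod w = 1" "cmod S = 1"
    using unit norm_step foot_norm by (auto simp: z_def w_def S_def)
  have "phi z = S * (1 + \<i> * of_real (- t))" "phi w = S * (1 + \<i> * of_real r)"
    using phi_foot[of z] phi_step[OF n(1)] by (auto simp: z_def w_def S_def t_def r_def)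
  note part = chord_poly_partial_foot[OF n(1,3) this(1)] chord_poly_partial_foot[OF n(2,3) this(2)]
  have sum: "D * (z + w) = - b" using step_sum[OF n(1)] by (simp add: D_def b_def z_def w_def S_def)
  then have b: "b = - (D * (z + w))" by simp
  \<comment> \<open>At a root, the derivative of a quadratic is its leading coefficient times the
    difference of the roots.\<close>
  have Dz: "2 * D * z + b = D * (z - w)" and Dw: "2 * D * w + b = D * (w - z)"
    unfolding b by (simp_all add: algebra_simps)
  \<comment> \<open>Both ends satisfy \<open>chord_poly = 0\<close> throughout the motion.
    Differentiating the two equations and eliminating the rate \<open>S'\<close> of the contact
    point determines \<open>w'\<close>.\<close>
  have "((\<lambda>x. 0) has_vector_derivative - 2 * \<i> * of_real (- t) * z * S' + D * (z - w) * (\<i> * z * t * k)) (at a)"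
    using chord_poly_deriv[OF S' d] chord_poly_foot[OF unit] part(1) Dz
    by (simp add: z_def S_def D_def b_def t_def)
  then have 1: "- 2 * \<i> * of_real (- t) * z * S' + D * (z - w) * (\<i> * z * t * k) = 0"
    using has_vector_derivative_const vector_derivative_unique_at by blast
  have "((\<lambda>x. 0) has_vector_derivative - 2 * \<i> * r * w * S' + D * (w - z) * w') (at a)"
    using chord_poly_deriv[OF S' w'] chord_poly_step[OF unit] part(2) Dw
    by (simp add: w_def S_def D_def b_def r_def)
  then have 2: "- 2 * \<i> * r * w * S' + D * (w - z) * w' = 0"
    using has_vector_derivative_const vector_derivative_unique_at by blast
  have nz: "t \<noteq> 0" "z \<noteq> 0" "D \<noteq> 0" "w - z \<noteq> 0"
    using tlen_pos[OF n(1)] n lead_nz[OF n(3)] step_neq[OF n(1)] by (auto simp: t_def z_def w_def D_def)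
  have "\<i> * t * z * (2 * S' + D * (z - w) * k) = 0" using 1 by (simp add: algebra_simps)
  then have S'2: "2 * S' + D * (z - w) * k = 0" using nz by simp
  have "D * (w - z) * w' = D * (w - z) * (\<i> * w * r * k)" using 2 S'2 by algebra
  then have "w' = \<i> * w * r * k" using nz by simp
  then show ?thesis using w' by (simp add: w_def r_def)
qed

lemma norm_step_funpow: "cmod z = 1 \<Longrightarrow> cmod ((step ^^ i) z) = 1"
  by (induction i) (auto simp: norm_step)

lemma step_funpow_has_vector_derivative:
  "((\<lambda>x. (step ^^ i) (cis x)) has_vector_derivative
      \<i> * (step ^^ i) (cis a) * tlen ((step ^^ i) (cis a)) * (1 / tlen (cis a))) (at a)"
proof (induction i)
  case 0
  have "(cis has_vector_derivative \<i> * cis a) (at a)"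
    by (simp add: has_vector_derivative_def has_derivative_cis mult.commute scaleR_conv_of_real)
      (auto intro!: derivative_eq_intros simp: scaleR_conv_of_real)
  then show ?case using tlen_pos[of "cis a"] by simp
next
  case (Suc i)
  have "((\<lambda>x. step ((step ^^ i) (cis x))) has_vector_derivative
     \<i> * step ((step ^^ i) (cis a)) * tlen (step ((step ^^ i) (cis a))) * (1 / tlen (cis a))) (at a)"
    by (rule step_has_vector_derivative) (use Suc in \<open>auto simp: norm_step_funpow\<close>)
  then show ?case by simp
qed

end

section \<open>Uniform period\<close>

text \<open>The Cayley transform with pole \<open>a\<close> is real on the unit circle, where
  conjugation is inversion, so taking \<open>Re\<close> loses nothing.\<close>

lemma inverse_cayley:
  fixes a z :: complex
  assumes "cmod a = 1" "cmod z = 1" "z \<noteq> a"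
  shows "a * (of_real (Re (\<i> * (z + a) / (z - a))) + \<i>) / (of_real (Re (\<i> * (z + a) / (z - a))) - \<i>) = z"
proof -
  define h where "h = \<i> * (z + a) / (z - a)"
  have nz: "a \<noteq> 0" "z \<noteq> 0" "z - a \<noteq> 0" using assms by auto
  have "cnj a = 1 / a" "cnj z = 1 / z"
    using assms nz by (simp_all add: field_simps complex_norm_square[symmetric])
  then have "cnj h = h" using nz assms(3) by (simp add: h_def divide_simps) algebra
  then have h: "complex_of_real (Re h) = h" by (metis Reals_cnj_iff of_real_Re)
  have "(h - \<i>) * (z - a) = 2 * \<i> * a" "(h + \<i>) * (z - a) = 2 * \<i> * z"
    unfolding h_def using nz by (auto simp: field_simps)
  then have e: "h - \<i> = 2 * \<i> * a / (z - a)" "h + \<i> = 2 * \<i> * z / (z - a)"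
    using nz by (auto simp: field_simps)
  have "a * (h + \<i>) / (h - \<i>) = z" unfolding e using nz by simp
  then show ?thesis using h by (simp add: h_def)
qed

lemma funpow_mono_fixed:
  fixes G :: "real \<Rightarrow> real"
  assumes mono: "strict_mono G" and "(G ^^ k) x = x" "k > 0"
  shows "G x = x"
proof (rule ccontr)
  assume ne: "G x \<noteq> x"
  have up: "(G ^^ Suc j) x > x" if "G x > x" for j
  proof (induction j)
    case (Suc j)
    have "G x < G ((G ^^ Suc j) x)" using Suc mono by (auto simp: strict_mono_def)
    then show ?case using that by simp
  qed (use that in simp)
  have down: "(G ^^ Suc j) x < x" if "G x < x" for j
  proof (induction j)
    case (Suc j)
    have "G x > G ((G ^^ Suc j) x)" using Suc mono by (auto simp: strict_mono_def)
    then show ?case using that by simp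
  qed (use that in simp)
  show False using up[of "k - 1"] down[of "k - 1"] ne assms(2,3) by (cases "G x > x") auto
qed

text \<open>Removing one fixed point turns the map into a monotone map of the line; the other two
  fixed points exclude that it is decreasing, and an increasing map of finite order is trivial.\<close>

lemma circle_map_finite_order_eq_id:
  fixes g :: "complex \<Rightarrow> complex"
  assumes cont: "continuous_on (sphere 0 1) g" and inj: "inj_on g (sphere 0 1)"
    and maps: "g ` sphere 0 1 \<subseteq> sphere 0 1"
    and fixed: "g a = a" "g b = b" "g d = d" "cmod a = 1" "cmod b = 1" "cmod d = 1"
      "a \<noteq> b" "b \<noteq> d" "a \<noteq> d"
    and order: "k > 0" "\<And>z. cmod z = 1 \<Longrightarrow> (g ^^ k) z = z"
    and z: "cmod z = 1"
  shows "g z = z"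
proof (cases "z = a")
  case False
  \<comment> \<open>Mutually inverse coordinates \<open>\<psi>\<close> and \<open>\<kappa>\<close>
    between the real line and the circle without the fixed point \<open>a\<close>.\<close>
  define \<psi> :: "real \<Rightarrow> complex" where "\<psi> x = a * (of_real x + \<i>) / (of_real x - \<i>)" for x
  define \<kappa> :: "complex \<Rightarrow> real" where "\<kappa> z = Re (\<i> * (z + a) / (z - a))" for z
  have nz: "complex_of_real x - \<i> \<noteq> 0" "complex_of_real x + \<i> \<noteq> 0" for x
    by (auto simp: complex_eq_iff)
  have a0: "a \<noteq> 0" using fixed by auto
  have \<psi>\<kappa>: "\<psi> (\<kappa> w) = w" if "cmod w = 1" "w \<noteq> a" for w
    unfolding \<psi>_def \<kappa>_def using inverse_cayley[OF fixed(4) that] .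
  have \<psi>1: "cmod (\<psi> x) = 1" for x
  proof -
    have "cmod (of_real x + \<i>) = cmod (of_real x - \<i>)" by (simp add: cmod_def)
    then show ?thesis using nz[of x] by (simp add: \<psi>_def norm_mult norm_divide fixed)
  qed
  have \<psi>a: "\<psi> x \<noteq> a" for x
  proof
    assume "\<psi> x = a"
    then have "a * (of_real x + \<i>) = a * (of_real x - \<i>)" using nz[of x] by (simp add: \<psi>_def divide_simps)
    then have "complex_of_real x + \<i> = of_real x - \<i>" using a0 by (simp only: mult_cancel_left) simp
    then show False by (simp add: complex_eq_iff)
  qed
  have \<kappa>\<psi>: "\<kappa> (\<psi> x) = x" for x
  proof -
    have "\<psi> x + a = 2 * a * x / (x - \<i>)" "\<psi> x - a = 2 * a * \<i> / (x - \<i>)"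
      using nz[of x] by (auto simp: \<psi>_def field_simps)
    then show ?thesis using nz[of x] a0 by (simp add: \<kappa>_def)
  qed
  define G where "G x = \<kappa> (g (\<psi> x))" for x
  have g1: "cmod (g w) = 1" if "cmod w = 1" for w using subsetD[OF maps imageI, of w] that by simp
  have ga: "g w \<noteq> a" if "cmod w = 1" "w \<noteq> a" for w
    using inj_onD[OF inj, of w a] that fixed by auto
  have \<psi>G: "\<psi> (G x) = g (\<psi> x)" for x
    unfolding G_def by (intro \<psi>\<kappa> g1 ga \<psi>1 \<psi>a)
  have contG: "continuous_on UNIV G"
  proof -
    have c1: "continuous_on UNIV \<psi>" unfolding \<psi>_def using nz by (intro continuous_intros) auto
    have "continuous_on UNIV (\<lambda>x. g (\<psi> x))"
      by (rule continuous_on_compose2[OF cont c1]) (auto simp: \<psi>1)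
    then show ?thesis unfolding G_def \<kappa>_def using ga[OF \<psi>1 \<psi>a]
      by (intro continuous_intros) auto
  qed
  have injG: "inj G"
  proof (rule injI)
    fix x y assume "G x = G y"
    then have "g (\<psi> x) = g (\<psi> y)" using \<psi>G by metis
    then have "\<psi> x = \<psi> y" using inj_onD[OF inj] \<psi>1 by auto
    then show "x = y" using \<kappa>\<psi> by metis
  qed
  have Gb: "G (\<kappa> b) = \<kappa> b" "G (\<kappa> d) = \<kappa> d"
    using \<psi>\<kappa> fixed by (auto simp: G_def)
  have bd: "\<kappa> b \<noteq> \<kappa> d" using \<psi>\<kappa> fixed by metis
  have "strict_mono_on UNIV G \<or> strict_antimono_on UNIV G"
    using injective_eq_monotone_map[of UNIV G] contG injG by auto
  moreover have "\<not> strict_antimono_on UNIV G"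
  proof
    assume "strict_antimono_on UNIV G"
    then have *: "G y < G x" if "x < y" for x y using that by (auto simp: monotone_on_def)
    show False using *[of "\<kappa> b" "\<kappa> d"] *[of "\<kappa> d" "\<kappa> b"] Gb bd by (cases "\<kappa> b < \<kappa> d") auto
  qed
  ultimately have mono: "strict_mono G" by simp
  have "\<psi> ((G ^^ j) x) = (g ^^ j) (\<psi> x)" for j x by (induction j) (auto simp: \<psi>G)
  then have "\<psi> ((G ^^ k) x) = \<psi> x" for x using order \<psi>1 by simp
  then have "(G ^^ k) x = x" for x using \<kappa>\<psi> by metis
  then have "G (\<kappa> z) = \<kappa> z" using funpow_mono_fixed[OF mono] order by blast
  then show ?thesis using \<psi>G[of "\<kappa> z"] \<psi>\<kappa>[OF z False] by simp
qed (use fixed in simp)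

lemma funpow_fixed_mult: "(f ^^ k) x = x \<Longrightarrow> (f ^^ (k * j)) x = x"
  by (induction j) (auto simp: funpow_add)

section \<open>The Poncelet map as a continuous injective circle map, and its least period\<close>

context poncelet_pair begin

lemma continuous_on_step: "continuous_on (sphere 0 1) step"
proof -
  have 1: "1 - \<i> * complex_of_real t \<noteq> 0" for t by (rule one_plus_i_nz)
  have phi: "continuous_on (sphere 0 1) phi" unfolding phi_def by (intro continuous_intros)
  have foot: "continuous_on (sphere 0 1) foot"
    unfolding foot_def tlen_def by (intro continuous_intros phi ballI 1)
  show ?thesis unfolding step_def
    using lead_nz[OF foot_norm] by (intro continuous_intros foot) auto
qed

lemma step_funpow_circle_map:
  "continuous_on (sphere 0 1) (step ^^ k)" "inj_on (step ^^ k) (sphere 0 1)"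
  "(step ^^ k) ` sphere 0 1 \<subseteq> sphere 0 1"
proof -
  show "(step ^^ k) ` sphere 0 1 \<subseteq> sphere 0 1" for k by (auto simp: norm_step_funpow)
  show "continuous_on (sphere 0 1) (step ^^ k)"
  proof (induction k)
    case (Suc k)
    have "continuous_on (sphere 0 1) (\<lambda>z. step ((step ^^ k) z))"
      by (rule continuous_on_compose2[OF continuous_on_step Suc]) (auto simp: norm_step_funpow)
    then show ?case by (simp add: comp_def)
  qed (simp add: id_def)
  show "inj_on (step ^^ k) (sphere 0 1)"
  proof (induction k)
    case (Suc k)
    show ?case
    proof (rule inj_onI)
      fix z w :: complex assume a: "z \<in> sphere 0 1" "w \<in> sphere 0 1" "(step ^^ Suc k) z = (step ^^ Suc k) w"
      then have "(step ^^ k) z = (step ^^ k) w" using step_inj[OF norm_step_funpow norm_step_funpow] by auto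
      then show "z = w" using Suc a by (auto dest: inj_onD)
    qed
  qed simp
qed

end

locale poncelet_closed = poncelet_pair +
  fixes n :: nat
  assumes n_pos: "n > 0" and closed: "cmod z = 1 \<Longrightarrow> (step ^^ n) z = z"
begin

text \<open>The power \<open>step ^^ k\<close> commutes with \<open>step\<close>, so it fixes the
  three distinct points \<open>z0\<close>, \<open>step z0\<close>, \<open>step (step z0)\<close>.
  Its own \<open>n\<close>-th power is the identity, so the criterion for circle maps of finite
  order applies.\<close>

lemma step_funpow_fixed_all:
  assumes "cmod z0 = 1" "(step ^^ k) z0 = z0" "cmod z = 1"
  shows "(step ^^ k) z = z"
proof (rule circle_map_finite_order_eq_id[OF step_funpow_circle_map])
  have comm: "(step ^^ k) ((step ^^ j) z0) = (step ^^ j) ((step ^^ k) z0)" for j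
    by (metis add.commute comp_apply funpow_add)
  show "(step ^^ k) z0 = z0" "(step ^^ k) (step z0) = step z0"
    "(step ^^ k) (step (step z0)) = step (step z0)"
    using assms(2) comm[of 1] comm[of 2] by (simp_all add: numeral_2_eq_2)
  show "cmod z0 = 1" "cmod (step z0) = 1" "cmod (step (step z0)) = 1" "cmod z = 1"
    using assms norm_step by auto
  show "z0 \<noteq> step z0" "step z0 \<noteq> step (step z0)" "z0 \<noteq> step (step z0)"
    using step_neq norm_step step_step_neq assms by metis+
  show "n > 0" by (rule n_pos)
  have "((step ^^ k) ^^ n) w = (step ^^ (n * k)) w" for w by (simp add: funpow_mult mult.commute)
  then show "((step ^^ k) ^^ n) w = w" if "cmod w = 1" for w
    using funpow_fixed_mult[OF closed[OF that], of k] by simp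
qed

text \<open>An \<open>n\<close>-gon may run several times through a shorter polygon, while root
  counting needs distinct vertices. The base point 1 is arbitrary: all orbits have the same least
  period.\<close>

definition period :: nat where
  "period = (LEAST k. k > 0 \<and> (step ^^ k) 1 = 1)"

lemma period: "period > 0" "cmod z = 1 \<Longrightarrow> (step ^^ period) z = z"
proof -
  have "period > 0 \<and> (step ^^ period) 1 = 1"
    unfolding period_def by (rule LeastI[of _ n]) (use n_pos closed in auto)
  then show "period > 0" "cmod z = 1 \<Longrightarrow> (step ^^ period) z = z"
    using step_funpow_fixed_all[of 1 period z] by auto
qed

lemma period_least:
  assumes "cmod z = 1" "(step ^^ k) z = z" "k < period" shows "k = 0"
  using step_funpow_fixed_all[OF assms(1,2), of 1] assms(3) 
    not_less_Least[of k "\<lambda>k. k > 0 \<and> (step ^^ k) 1 = 1"]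
  unfolding period_def by auto

lemma orbit_inj:
  assumes "cmod z = 1" shows "inj_on (\<lambda>i. (step ^^ i) z) {..<period}"
proof -
  have "i = j" if "i \<le> j" "j < period" "(step ^^ i) z = (step ^^ j) z" for i j
  proof -
    have "(step ^^ (j - i)) ((step ^^ i) z) = (step ^^ i) z"
      using that by (metis add.commute comp_apply funpow_add le_add_diff_inverse)
    then have "j - i = 0" using period_least norm_step_funpow assms that
      by (metis less_imp_diff_less)
    then show ?thesis using that by simp
  qed
  then show ?thesis by (auto simp: inj_on_def) (metis nat_le_linear)
qed

lemma period_dvd: "period dvd n"
proof -
  have "(step ^^ (n mod period)) ((step ^^ (period * (n div period))) 1) = 1"
    using closed[of 1] by (metis comp_apply funpow_add mod_mult_div_eq norm_one)
  then have "(step ^^ (n mod period)) 1 = 1" using funpow_fixed_mult[OF period(2), of 1] by simp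
  then have "n mod period = 0" using period_least[of 1] period(1) by simp
  then show ?thesis by auto
qed

end

section \<open>The pencil of orbit polynomials\<close>

lemma prod_linear_coeffs:
  fixes f :: "nat \<Rightarrow> 'a::idom"
  defines "P \<equiv> \<lambda>k. \<Prod>i<k. [:- f i, 1:]"
  shows "degree (P k) = k" "coeff (P k) k = 1" "coeff (P (Suc k)) k = - (\<Sum>i<Suc k. f i)"
    "coeff (P k) 0 = (- 1) ^ k * (\<Prod>i<k. f i)"
proof -
  show deg: "degree (P k) = k" for k
    unfolding P_def by (subst degree_prod_eq_sum_degree) auto
  show lead: "coeff (P k) k = 1" for k
    using lead_coeff_prod[of "\<lambda>i. [:- f i, 1:]" "{..<k}"] deg[of k] by (simp add: P_def)
  have S: "P (Suc k) = smult (- f k) (P k) + pCons 0 (P k)" for k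
    by (simp add: P_def mult.commute[of _ "[:- f k, 1:]"])
  show "coeff (P k) 0 = (- 1) ^ k * (\<Prod>i<k. f i)"
    by (induction k) (simp add: P_def, simp add: S)
  show "coeff (P (Suc k)) k = - (\<Sum>i<Suc k. f i)"
  proof (induction k)
    case 0 show ?case by (simp add: P_def)
  next
    case (Suc k)
    have "coeff (P (Suc (Suc k))) (Suc k) = - f (Suc k) * coeff (P (Suc k)) (Suc k) + coeff (P (Suc k)) k"
      by (subst S) simp
    then show ?case using Suc lead[of "Suc k"] by simp
  qed
qed

context poncelet_pair begin

text \<open>Vieta's relations for the two roots of \<open>chord_poly S\<close>: symmetric functions
  of \<open>z\<close> and \<open>w\<close> become polynomials in \<open>S\<close> once powers of the
  leading coefficient clear the denominators.\<close>

definition chord :: "complex \<Rightarrow> complex \<Rightarrow> complex \<Rightarrow> bool" where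
  "chord S z w \<longleftrightarrow> (p + cnj q * S\<^sup>2) * (z + w) = - (c + cnj c * S\<^sup>2 - 2 * S) \<and>
     (p + cnj q * S\<^sup>2) * (z * w) = q + cnj p * S\<^sup>2"

text \<open>Divided by \<open>z - w\<close>, the power difference is the complete symmetric
  polynomial \<open>h_k\<close>, and \<open>h_k = (z + w) * h_(k-1) - z * w * h_(k-2)\<close>. By
  Vieta each unit of \<open>k\<close> costs one leading coefficient and two degrees in
  \<open>S\<close>.\<close>

lemma chord_power_diff:
  "\<exists>U. degree U \<le> 2 * k \<and> (\<forall>S z w. chord S z w \<longrightarrow>
     (p + cnj q * S\<^sup>2) ^ k * (z ^ Suc k - w ^ Suc k) = (z - w) * poly U S)"
proof (induction k rule: less_induct)
  case (less k)
  define b where "b = [:- c, 2, - cnj c:]"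
  define e where "e = [:q, 0, cnj p:] * [:p, 0, cnj q:]"
  have b: "degree b \<le> 2" and e: "degree e \<le> 4"
    using degree_mult_le[of "[:q, 0, cnj p:]" "[:p, 0, cnj q:]"]
    by (auto simp: b_def e_def split: if_splits)
  have bS: "(p + cnj q * S\<^sup>2) * (z + w) = poly b S" if "chord S z w" for S z w
    using that by (simp add: chord_def b_def algebra_simps power2_eq_square)
  have eS: "(p + cnj q * S\<^sup>2)\<^sup>2 * (z * w) = poly e S" if "chord S z w" for S z w
  proof -
    have "poly e S = (p + cnj q * S\<^sup>2) * (q + cnj p * S\<^sup>2)"
      by (simp add: e_def power2_eq_square algebra_simps)
    moreover have "(p + cnj q * S\<^sup>2) * (z * w) = q + cnj p * S\<^sup>2" using that by (simp add: chord_def)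
    ultimately show ?thesis by (metis mult.assoc power2_eq_square)
  qed
  consider "k = 0" | "k = 1" | l where "k = Suc (Suc l)" by (metis One_nat_def not0_implies_Suc)
  then show ?case
  proof cases
    case 1 then show ?thesis by (intro exI[of _ 1]) auto
  next
    case 2
    have "(p + cnj q * S\<^sup>2) * (z\<^sup>2 - w\<^sup>2) = (z - w) * poly b S" if "chord S z w" for S z w
      unfolding bS[OF that, symmetric] by algebra
    then show ?thesis using b 2 by (intro exI[of _ b]) (auto simp: power2_eq_square)
  next
    case (3 l)
    obtain U where U: "degree U \<le> 2 * Suc l" "\<And>S z w. chord S z w \<Longrightarrow>
        (p + cnj q * S\<^sup>2) ^ Suc l * (z ^ Suc (Suc l) - w ^ Suc (Suc l)) = (z - w) * poly U S"
      using less[of "Suc l"] 3 by blast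
    obtain V where V: "degree V \<le> 2 * l" "\<And>S z w. chord S z w \<Longrightarrow>
        (p + cnj q * S\<^sup>2) ^ l * (z ^ Suc l - w ^ Suc l) = (z - w) * poly V S"
      using less[of l] 3 by auto
    have "degree (b * U - e * V) \<le> 2 * k"
      using b e U(1) V(1) 3
      by (intro degree_diff_le) (auto intro!: order_trans[OF degree_mult_le])
    moreover have "(p + cnj q * S\<^sup>2) ^ k * (z ^ Suc k - w ^ Suc k) = (z - w) * poly (b * U - e * V) S"
      if ch: "chord S z w" for S z w
    proof -
      define D where "D = p + cnj q * S\<^sup>2"
      have "D ^ k * (z ^ Suc k - w ^ Suc k) =
          D * (z + w) * (D ^ Suc l * (z ^ Suc (Suc l) - w ^ Suc (Suc l)))
          - D\<^sup>2 * (z * w) * (D ^ l * (z ^ Suc l - w ^ Suc l))"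
        unfolding 3 by (simp add: algebra_simps power2_eq_square)
      also have "\<dots> = (z - w) * poly (b * U - e * V) S"
        unfolding D_def bS[OF ch] eS[OF ch] U(2)[OF ch] V(2)[OF ch] by (simp add: algebra_simps)
      finally show ?thesis by (simp add: D_def)
    qed
    ultimately show ?thesis by blast
  qed
qed

lemma chord_monomials:
  assumes "i \<le> Suc m" "j \<le> Suc m"
  shows "\<exists>U. degree U \<le> 2 * m \<and> (\<forall>S z w. chord S z w \<longrightarrow>
     (p + cnj q * S\<^sup>2) ^ m * (z ^ i * w ^ j - z ^ j * w ^ i) = (z - w) * poly U S)"
proof -
  have main: "\<exists>U. degree U \<le> 2 * m \<and> (\<forall>S z w. chord S z w \<longrightarrow>
     (p + cnj q * S\<^sup>2) ^ m * (z ^ i * w ^ j - z ^ j * w ^ i) = (z - w) * poly U S)"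
    if "j < i" "i \<le> Suc m" for i j
  proof -
    obtain k where k: "i = j + Suc k" using \<open>j < i\<close> less_iff_Suc_add by auto
    obtain U where U: "degree U \<le> 2 * k" "\<And>S z w. chord S z w \<Longrightarrow>
        (p + cnj q * S\<^sup>2) ^ k * (z ^ Suc k - w ^ Suc k) = (z - w) * poly U S"
      using chord_power_diff by blast
    define d where "d = [:p, 0, cnj q:]"
    define e where "e = [:q, 0, cnj p:]"
    have de: "degree d \<le> 2" "degree e \<le> 2" by (auto simp: d_def e_def)
    \<comment> \<open>Since \<open>i = j + k + 1\<close> is at most \<open>m + 1\<close>, the
      \<open>m\<close> leading coefficients suffice: \<open>j\<close> of them for the powers of
      \<open>z * w\<close>, \<open>k\<close> for the power difference, and the rest stay as a
      factor.\<close>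
    have m: "m = (m - j - k) + j + k" using that k by simp
    have "degree (d ^ (m - j - k) * e ^ j * U) \<le> degree (d ^ (m - j - k)) + degree (e ^ j) + degree U"
      by (meson add_right_mono degree_mult_le order_trans)
    also have "\<dots> \<le> 2 * (m - j - k) + 2 * j + 2 * k"
      using U(1) de by (intro add_mono order_trans[OF degree_power_le]) auto
    also have "\<dots> = 2 * m" using m by simp
    finally have "degree (d ^ (m - j - k) * e ^ j * U) \<le> 2 * m" .
    moreover have "(p + cnj q * S\<^sup>2) ^ m * (z ^ i * w ^ j - z ^ j * w ^ i)
       = (z - w) * poly (d ^ (m - j - k) * e ^ j * U) S" if ch: "chord S z w" for S z w
    proof -
      define D where "D = p + cnj q * S\<^sup>2"
      have dS: "poly d S = D" by (simp add: d_def D_def power2_eq_square)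
      have eS: "poly e S = D * (z * w)"
        using ch by (simp add: e_def D_def chord_def power2_eq_square)
      have "D ^ m = D ^ (m - j - k) * D ^ j * D ^ k" by (subst m) (simp add: power_add)
      then have "D ^ m * (z ^ i * w ^ j - z ^ j * w ^ i)
          = D ^ (m - j - k) * (D * (z * w)) ^ j * (D ^ k * (z ^ Suc k - w ^ Suc k))"
        unfolding k by (simp add: power_add power_mult_distrib algebra_simps)
      also have "\<dots> = (z - w) * poly (d ^ (m - j - k) * e ^ j * U) S"
        unfolding poly_mult poly_power dS eS U(2)[OF ch, folded D_def] by (simp only: mult_ac)
      finally show ?thesis by (simp add: D_def)
    qed
    ultimately show ?thesis by blast
  qed
  consider "i = j" | "j < i" | "i < j" by linarith
  then show ?thesis
  proof cases
    case 1 then show ?thesis by (intro exI[of _ 0]) auto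
  next
    case 2 then show ?thesis using main assms by blast
  next
    case 3
    obtain U where "degree U \<le> 2 * m" "\<And>S z w. chord S z w \<Longrightarrow>
       (p + cnj q * S\<^sup>2) ^ m * (z ^ j * w ^ i - z ^ i * w ^ j) = (z - w) * poly U S"
      using main[OF 3 assms(2)] by blast
    then show ?thesis by (intro exI[of _ "- U"]) (auto simp: algebra_simps)
  qed
qed

text \<open>The tangent lines of the inner conic are parametrised by \<^term>\<open>S\<close>; restricting to it the
  Bezoutian of two polynomials, a curve of class \<^term>\<open>m\<close>, gives degree \<^term>\<open>2 * m\<close>.\<close>

lemma bezoutian_on_chords:
  assumes "degree P \<le> Suc m" "degree Q \<le> Suc m"
  shows "\<exists>V. degree V \<le> 2 * m \<and> (\<forall>S z w. chord S z w \<longrightarrow>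
     (p + cnj q * S\<^sup>2) ^ m * (poly P z * poly Q w - poly P w * poly Q z) = (z - w) * poly V S)"
proof -
  have "\<forall>i\<in>{..Suc m}. \<forall>j\<in>{..Suc m}. \<exists>U. degree U \<le> 2 * m \<and> (\<forall>S z w. chord S z w \<longrightarrow>
     (p + cnj q * S\<^sup>2) ^ m * (z ^ i * w ^ j - z ^ j * w ^ i) = (z - w) * poly U S)"
    using chord_monomials by auto
  then obtain U where U: "\<And>i j. i \<le> Suc m \<Longrightarrow> j \<le> Suc m \<Longrightarrow> degree (U i j) \<le> 2 * m"
    "\<And>i j S z w. i \<le> Suc m \<Longrightarrow> j \<le> Suc m \<Longrightarrow> chord S z w \<Longrightarrow>
     (p + cnj q * S\<^sup>2) ^ m * (z ^ i * w ^ j - z ^ j * w ^ i) = (z - w) * poly (U i j) S"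
    by (metis atMost_iff)
  define V where "V = (\<Sum>i\<le>Suc m. \<Sum>j\<le>Suc m. smult (coeff P i * coeff Q j) (U i j))"
  have "degree V \<le> 2 * m" unfolding V_def
    by (intro degree_sum_le order_trans[OF degree_smult_le] U(1)) auto
  moreover have "(p + cnj q * S\<^sup>2) ^ m * (poly P z * poly Q w - poly P w * poly Q z) = (z - w) * poly V S"
    if ch: "chord S z w" for S z w
  proof -
    define D where "D = (p + cnj q * S\<^sup>2) ^ m"
    have ev: "poly R x = (\<Sum>i\<le>Suc m. coeff R i * x ^ i)" if "degree R \<le> Suc m" for R and x :: complex
      unfolding poly_altdef using that
      by (intro sum.mono_neutral_left) (auto simp: not_le coeff_eq_0)
    have "D * (poly P z * poly Q w - poly P w * poly Q z)
      = (\<Sum>i\<le>Suc m. \<Sum>j\<le>Suc m. coeff P i * coeff Q j * (D * (z ^ i * w ^ j - z ^ j * w ^ i)))"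
      unfolding ev[OF assms(1)] ev[OF assms(2)] sum_product
      by (simp only: sum_distrib_left sum_subtractf[symmetric] right_diff_distrib mult_ac)
    also have "\<dots> = (\<Sum>i\<le>Suc m. \<Sum>j\<le>Suc m. coeff P i * coeff Q j * ((z - w) * poly (U i j) S))"
      unfolding D_def by (intro sum.cong refl) (simp only: U(2) ch atMost_iff)
    also have "\<dots> = (z - w) * poly V S"
      unfolding V_def poly_sum poly_smult sum_distrib_left by (simp only: mult_ac)
    finally show ?thesis by (simp add: D_def)
  qed
  ultimately show ?thesis by blast
qed

end

section \<open>Orbit polynomials and Darboux's argument\<close>

context poncelet_closed begin

abbreviation orb :: "complex \<Rightarrow> nat \<Rightarrow> complex" where
  "orb z i \<equiv> (step ^^ i) z"

definition orbit_poly :: "complex \<Rightarrow> complex poly" where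
  "orbit_poly z = (\<Prod>i<period. [:- orb z i, 1:])"

definition vertex_prod :: "complex \<Rightarrow> complex" where
  "vertex_prod z = (\<Prod>i<period. orb z i)"

definition vertex_sum :: "complex \<Rightarrow> complex" where
  "vertex_sum z = (\<Sum>i<period. orb z i)"

lemma orbit_poly_root: "poly (orbit_poly z) x = 0 \<longleftrightarrow> (\<exists>i<period. x = orb z i)"
  unfolding orbit_poly_def by (simp add: poly_prod) (metis lessThan_iff)

lemma orbit_poly_coeffs:
  "degree (orbit_poly z) = period" "coeff (orbit_poly z) period = 1"
  "coeff (orbit_poly z) (period - 1) = - vertex_sum z"
  "coeff (orbit_poly z) 0 = (- 1) ^ period * vertex_prod z"
proof -
  note c = prod_linear_coeffs[of "orb z"]
  show "degree (orbit_poly z) = period" "coeff (orbit_poly z) period = 1"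
    "coeff (orbit_poly z) 0 = (- 1) ^ period * vertex_prod z"
    using c(1,2,4)[of period] by (auto simp: orbit_poly_def vertex_prod_def)
  show "coeff (orbit_poly z) (period - 1) = - vertex_sum z"
    using c(3)[of "period - 1"] period(1) by (simp add: orbit_poly_def vertex_sum_def)
qed

lemma orbit_mod_period:
  assumes "cmod z = 1" shows "\<exists>j<period. orb z i = orb z j"
proof -
  have "orb z i = orb z (i mod period + period * (i div period))" by simp
  also have "\<dots> = orb z (i mod period)"
    unfolding funpow_add comp_apply using funpow_fixed_mult[OF period(2)[OF assms]] by simp
  finally show ?thesis using period(1) by (intro exI[of _ "i mod period"]) auto
qed

lemma vertex_prod_step:
  assumes "cmod z = 1" shows "vertex_prod (step z) = vertex_prod z"
proof -
  obtain k where k: "period = Suc k" using period(1) by (metis Suc_pred)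
  have "vertex_prod (step z) = (\<Prod>i<Suc k. orb z (Suc i))"
    unfolding vertex_prod_def k by (simp only: funpow_Suc_right comp_apply)
  also have "\<dots> = (\<Prod>i<k. orb z (Suc i)) * orb z period" by (simp add: k)
  also have "\<dots> = vertex_prod z"
    unfolding vertex_prod_def k prod.lessThan_Suc_shift
    using period(2)[OF assms] by (simp add: k mult.commute)
  finally show ?thesis .
qed

lemma vertex_prod_funpow: "cmod z = 1 \<Longrightarrow> vertex_prod (orb z i) = vertex_prod z"
  by (induction i) (auto simp: vertex_prod_step norm_step_funpow)

lemma norm_vertex_prod: "cmod z = 1 \<Longrightarrow> cmod (vertex_prod z) = 1"
  by (simp add: vertex_prod_def prod_norm[symmetric] norm_step_funpow)

lemma chord_step: "cmod z = 1 \<Longrightarrow> chord (foot z) z (step z)"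
  using step_sum step_prod by (simp add: chord_def)

text \<open>Darboux's argument: the Bezoutian of two orbit polynomials vanishes on the \<^term>\<open>2 * period\<close>
  sides of the two polygons, which is more than its degree \<^term>\<open>2 * (period - 1)\<close> on the inner
  conic, hence it vanishes on all tangent chords.\<close>

lemma orbit_poly_ratio:
  assumes a: "cmod a = 1" and b: "cmod b = 1" and ne: "vertex_prod a \<noteq> vertex_prod b"
    and z: "cmod z = 1"
  shows "poly (orbit_poly a) z * poly (orbit_poly b) (step z)
       = poly (orbit_poly a) (step z) * poly (orbit_poly b) z"
proof -
  let ?P = "orbit_poly a" and ?Q = "orbit_poly b"
  obtain k where k: "period = Suc k" using period(1) by (metis Suc_pred)
  obtain V where V: "degree V \<le> 2 * k" "\<And>S z w. chord S z w \<Longrightarrow>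
     (p + cnj q * S\<^sup>2) ^ k * (poly ?P z * poly ?Q w - poly ?P w * poly ?Q z) = (z - w) * poly V S"
    using bezoutian_on_chords[of ?P k ?Q] orbit_poly_coeffs(1) k by auto
  \<comment> \<open>Both ends of a side of either polygon are roots of the same orbit polynomial, so
    both terms of the Bezoutian vanish there; the ends are distinct, which leaves a zero of
    \<open>V\<close> at the contact point.\<close>
  have V0: "poly V (foot (orb x i)) = 0" if x: "x = a \<or> x = b" for x i
  proof -
    have n: "cmod (orb x i) = 1" using norm_step_funpow a b x by auto
    have "poly (orbit_poly x) (orb x i) = 0" "poly (orbit_poly x) (step (orb x i)) = 0"
      using orbit_mod_period[of x i] orbit_mod_period[of x "Suc i"] a b x orbit_poly_root by auto
    then have "(orb x i - step (orb x i)) * poly V (foot (orb x i)) = 0"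
      using V(2)[OF chord_step[OF n]] x by auto
    then show ?thesis using step_neq[OF n] by auto
  qed
  define A where "A x = (\<lambda>i. foot (orb x i)) ` {..<period}" for x
  have cardA: "card (A x) = period" if "cmod x = 1" for x
    unfolding A_def using orbit_inj[OF that] foot_inj norm_step_funpow[OF that]
    by (subst card_image) (auto simp: inj_on_def)
  \<comment> \<open>\<open>vertex_prod\<close> is constant along orbits, so the two orbits are
    disjoint; by injectivity of \<open>foot\<close>, so are their sets of contact points.\<close>
  have disj: "A a \<inter> A b = {}"
  proof (rule ccontr)
    assume "A a \<inter> A b \<noteq> {}"
    then obtain i j where "foot (orb a i) = foot (orb b j)" by (auto simp: A_def)
    then have "orb a i = orb b j" using foot_inj norm_step_funpow a b by blast
    then show False using vertex_prod_funpow[OF a, of i] vertex_prod_funpow[OF b, of j] ne by simp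
  qed
  have "V = 0"
  proof (rule ccontr)
    assume "V \<noteq> 0"
    then have "card {x. poly V x = 0} \<le> 2 * k" using card_poly_roots_bound V(1) order_trans by blast
    moreover have "card (A a \<union> A b) \<le> card {x. poly V x = 0}"
      using V0 poly_roots_finite[OF \<open>V \<noteq> 0\<close>] by (intro card_mono) (auto simp: A_def)
    moreover have "card (A a \<union> A b) = 2 * period"
      using disj cardA a b by (subst card_Un_disjoint) (auto simp: A_def)
    ultimately show False using k by simp
  qed
  then have "(p + cnj q * (foot z)\<^sup>2) ^ k *
      (poly ?P z * poly ?Q (step z) - poly ?P (step z) * poly ?Q z) = 0"
    using V(2)[OF chord_step[OF z]] by simp
  then show ?thesis using lead_nz[OF foot_norm[OF z]] by simp
qed

text \<open>The ratio of the two given orbit polynomials is the same at all vertices of the orbit of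
  \<open>z\<close>. So one member of their pencil vanishes on that orbit and is proportional to
  \<open>orbit_poly z\<close>; leading coefficients make the weights sum to 1.\<close>

lemma orbit_poly_pencil:
  assumes a: "cmod a = 1" and b: "cmod b = 1" and ne: "vertex_prod a \<noteq> vertex_prod b"
    and z: "cmod z = 1"
  shows "\<exists>s. orbit_poly z = smult s (orbit_poly a) + smult (1 - s) (orbit_poly b)"
proof -
  define P Q where "P = orbit_poly a" and "Q = orbit_poly b"
  have nz: "poly P x \<noteq> 0 \<or> poly Q x \<noteq> 0" for x
    using ne vertex_prod_funpow[OF a] vertex_prod_funpow[OF b] unfolding P_def Q_def orbit_poly_root by metis
  have ratio: "poly Q z * poly P (orb z i) = poly P z * poly Q (orb z i)" for i
  proof (induction i)
    case (Suc i)
    define w where "w = orb z i"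
    have "poly P w * poly Q (step w) = poly P (step w) * poly Q w"
      unfolding P_def Q_def w_def by (intro orbit_poly_ratio assms norm_step_funpow)
    \<comment> \<open>\<open>P\<close> and \<open>Q\<close> have no common root, so one of the
      factors \<open>poly P w\<close>, \<open>poly Q w\<close> cancels.\<close>
    then have "poly P w * (poly Q z * poly P (step w) - poly P z * poly Q (step w)) = 0"
      "poly Q w * (poly Q z * poly P (step w) - poly P z * poly Q (step w)) = 0"
      using Suc unfolding w_def[symmetric] by algebra+
    then show ?case using nz[of w] by (auto simp: w_def)
  qed simp
  \<comment> \<open>The leading coefficient of the pencil member that vanishes on the orbit.
    Subtracting \<open>\<kappa>\<close> times the monic \<open>orbit_poly z\<close> leaves degree
    below \<open>period\<close> but \<open>period\<close> distinct roots.\<close>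
  define \<kappa> where "\<kappa> = poly Q z - poly P z"
  define R where "R = smult (poly Q z) P - smult (poly P z) Q - smult \<kappa> (orbit_poly z)"
  have "R = 0"
  proof (rule ccontr)
    assume R: "R \<noteq> 0"
    have "coeff R i = 0" if "i \<ge> period" for i
      using that coeff_eq_0[of P i] coeff_eq_0[of Q i] coeff_eq_0[of "orbit_poly z" i]
        orbit_poly_coeffs(1,2) by (cases "i = period") (auto simp: R_def P_def Q_def \<kappa>_def)
    then have "degree R < period" using R by (metis leading_coeff_0_iff not_le)
    moreover have "card ((\<lambda>i. orb z i) ` {..<period}) \<le> card {x. poly R x = 0}"
      using poly_roots_finite[OF R] ratio orbit_poly_root[of z]
      by (intro card_mono) (auto simp: R_def)
    moreover have "card ((\<lambda>i. orb z i) ` {..<period}) = period"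
      using card_image[OF orbit_inj[OF z]] by simp
    ultimately show False using card_poly_roots_bound[OF R] by linarith
  qed
  then have eq: "smult \<kappa> (orbit_poly z) = smult (poly Q z) P - smult (poly P z) Q" by (simp add: R_def)
  have "\<kappa> \<noteq> 0"
  proof
    assume "\<kappa> = 0"
    then have "smult (poly P z) (P - Q) = 0" "poly P z \<noteq> 0"
      using eq nz[of z] by (auto simp: \<kappa>_def smult_diff_right)
    then have "P = Q" by simp
    then have "coeff P 0 = coeff Q 0" by simp
    then show False using ne orbit_poly_coeffs(4) by (simp add: P_def Q_def)
  qed
  then have "orbit_poly z = smult (1 / \<kappa>) (smult \<kappa> (orbit_poly z))" by simp
  also have "\<dots> = smult (poly Q z / \<kappa>) P + smult (1 - poly Q z / \<kappa>) Q"
  proof -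
    have "1 - poly Q z / \<kappa> = - (poly P z / \<kappa>)" using \<open>\<kappa> \<noteq> 0\<close> by (simp add: field_simps \<kappa>_def)
    then show ?thesis unfolding eq by (simp add: smult_diff_right)
  qed
  finally show ?thesis unfolding P_def Q_def by blast
qed

text \<open>Vertex sum and vertex product are, up to sign, coefficients of the orbit polynomial, so
  both depend affinely on one pencil parameter \<open>s\<close>, which is eliminated.\<close>

lemma vertex_sum_affine_of_distinct:
  assumes a: "cmod a = 1" and b: "cmod b = 1" and ne: "vertex_prod a \<noteq> vertex_prod b"
  shows "\<exists>\<alpha> \<beta>. \<forall>z. cmod z = 1 \<longrightarrow> vertex_sum z = \<alpha> + \<beta> * vertex_prod z"
proof -
  define \<beta> where "\<beta> = (vertex_sum a - vertex_sum b) / (vertex_prod a - vertex_prod b)"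
  have "vertex_sum z = (vertex_sum b - \<beta> * vertex_prod b) + \<beta> * vertex_prod z" if z: "cmod z = 1" for z
  proof -
    obtain s where s: "orbit_poly z = smult s (orbit_poly a) + smult (1 - s) (orbit_poly b)"
      using orbit_poly_pencil[OF a b ne z] by blast
    have "- vertex_sum z = s * - vertex_sum a + (1 - s) * - vertex_sum b"
      using arg_cong[OF s, of "\<lambda>P. coeff P (period - 1)"] by (simp only: coeff_add coeff_smult orbit_poly_coeffs)
    then have 1: "vertex_sum z = vertex_sum b + s * (vertex_sum a - vertex_sum b)" by algebra
    have "(- 1) ^ period * vertex_prod z
        = (- 1) ^ period * (s * vertex_prod a + (1 - s) * vertex_prod b)"
      using arg_cong[OF s, of "\<lambda>P. coeff P 0"] by (simp add: orbit_poly_coeffs algebra_simps)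
    then have "vertex_prod z = s * vertex_prod a + (1 - s) * vertex_prod b" by simp
    then have "vertex_prod z = vertex_prod b + s * (vertex_prod a - vertex_prod b)"
      by algebra
    then have "\<beta> * (vertex_prod z - vertex_prod b) = s * (vertex_sum a - vertex_sum b)"
      using ne by (simp add: \<beta>_def)
    then show ?thesis using 1 by algebra
  qed
  then show ?thesis by blast
qed

end

section \<open>The vertex product and the weighted vertex sum\<close>

lemma prod_has_vector_derivative:
  fixes f :: "'i \<Rightarrow> real \<Rightarrow> complex"
  assumes "finite I" "\<And>i. i \<in> I \<Longrightarrow> (f i has_vector_derivative \<i> * f i a * g i) (at a)"
  shows "((\<lambda>x. \<Prod>i\<in>I. f i x) has_vector_derivative \<i> * (\<Prod>i\<in>I. f i a) * (\<Sum>i\<in>I. g i)) (at a)"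
  using assms
proof (induction I rule: finite_induct)
  case (insert j J)
  have "((\<lambda>x. f j x * (\<Prod>i\<in>J. f i x)) has_vector_derivative
     f j a * (\<i> * (\<Prod>i\<in>J. f i a) * (\<Sum>i\<in>J. g i)) + \<i> * f j a * g j * (\<Prod>i\<in>J. f i a)) (at a)"
    using insert by (intro has_vector_derivative_mult) auto
  then show ?case using insert(1,2) by (simp add: algebra_simps)
qed simp

context poncelet_closed begin

definition len_sum :: "complex \<Rightarrow> real" where
  "len_sum z = (\<Sum>i<period. tlen (orb z i))"

lemma len_sum_pos: "cmod z = 1 \<Longrightarrow> len_sum z > 0"
  unfolding len_sum_def using period(1) by (intro sum_pos tlen_pos norm_step_funpow) auto

lemma vertex_prod_deriv:
  "((\<lambda>x. vertex_prod (cis x)) has_vector_derivative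
     \<i> * vertex_prod (cis a) * (len_sum (cis a) / tlen (cis a))) (at a)"
proof -
  have "((\<lambda>x. \<Prod>i<period. orb (cis x) i) has_vector_derivative
     \<i> * (\<Prod>i<period. orb (cis a) i) *
       (\<Sum>i<period. complex_of_real (tlen (orb (cis a) i)) * complex_of_real (1 / tlen (cis a)))) (at a)"
    using step_funpow_has_vector_derivative
    by (intro prod_has_vector_derivative) (auto simp: mult.assoc)
  then show ?thesis
    unfolding vertex_prod_def len_sum_def
    by (simp add: sum_divide_distrib)
qed

lemma vertex_sum_deriv:
  "((\<lambda>x. vertex_sum (cis x)) has_vector_derivative
     \<i> * (\<Sum>i<period. orb (cis a) i * tlen (orb (cis a) i)) * (1 / tlen (cis a))) (at a)"
  unfolding vertex_sum_def sum_distrib_left sum_distrib_right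
  using step_funpow_has_vector_derivative
  by (intro has_vector_derivative_sum) (auto simp: mult.assoc)

lemma vertex_prod_deriv_nz:
  "\<i> * vertex_prod (cis a) * (len_sum (cis a) / tlen (cis a)) \<noteq> 0"
  using norm_vertex_prod[of "cis a"] len_sum_pos[of "cis a"] tlen_pos[of "cis a"] by auto

text \<open>Two orbits with distinct products exist, since the derivative of the vertex product is
  nonzero.\<close>

lemma vertex_sum_affine:
  obtains \<alpha> \<beta> where "\<And>z. cmod z = 1 \<Longrightarrow> vertex_sum z = \<alpha> + \<beta> * vertex_prod z"
proof -
  have "\<exists>x. vertex_prod (cis x) \<noteq> vertex_prod (cis 0)"
  proof (rule ccontr)
    assume "\<not> ?thesis"
    then have "(\<lambda>x. vertex_prod (cis x)) = (\<lambda>x. vertex_prod (cis 0))" by auto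
    then have "((\<lambda>x. vertex_prod (cis x)) has_vector_derivative 0) (at 0)" by simp
    then show False using vertex_prod_deriv[of 0] vertex_prod_deriv_nz[of 0] vector_derivative_unique_at by blast
  qed
  then obtain x where "vertex_prod (cis x) \<noteq> vertex_prod (cis 0)" by blast
  from vertex_sum_affine_of_distinct[OF _ _ this] show ?thesis using that by (metis norm_cis)
qed

text \<open>If \<open>v\<close> were omitted, the Cayley transform with pole \<open>v\<close> would
  turn the vertex product into a differentiable real function on the circle. It has a maximum by
  compactness, yet its derivative never vanishes.\<close>

lemma vertex_prod_surj:
  assumes "cmod v = 1" shows "\<exists>z. cmod z = 1 \<and> vertex_prod z = v"
proof (rule ccontr)
  assume "\<not> ?thesis"
  then have ne: "vertex_prod (cis x) \<noteq> v" for x by auto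
  define u where "u x = vertex_prod (cis x)" for x
  define H where "H x = \<i> * (u x + v) / (u x - v)" for x
  define h where "h x = Re (H x)" for x
  have u1: "cmod (u x) = 1" for x by (simp add: u_def norm_vertex_prod)
  have v0: "v \<noteq> 0 \<and> u x \<noteq> 0 \<and> u x - v \<noteq> 0" for x using assms u1[of x] ne[of x] by (auto simp: u_def)
  have real: "Im (H x) = 0" for x
  proof -
    have "cnj v = 1 / v" "cnj (u x) = 1 / u x"
      using assms u1 v0 by (simp_all add: field_simps complex_norm_square[symmetric])
    then have "cnj (H x) = H x" using v0[of x] ne[of x] by (simp add: H_def u_def divide_simps) algebra
    then show ?thesis by (simp add: complex_eq_iff)
  qed
  define u' where "u' a = \<i> * vertex_prod (cis a) * (len_sum (cis a) / tlen (cis a))" for a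
  have Hd: "(H has_vector_derivative - 2 * \<i> * v * u' a / (u a - v)\<^sup>2) (at a)" for a
  proof -
    have ud: "(u has_vector_derivative u' a) (at a)"
      using vertex_prod_deriv unfolding u_def u'_def .
    have "((\<lambda>w. \<i> * (w + v) / (w - v)) has_field_derivative - 2 * \<i> * v / (u a - v)\<^sup>2) (at (u a))"
      using v0[of a] by (auto intro!: derivative_eq_intros simp: power2_eq_square field_simps)
    from field_vector_diff_chain_at[OF ud this] show ?thesis
      by (simp add: H_def[abs_def] comp_def mult_ac)
  qed
  have hd: "(h has_real_derivative Re (- 2 * \<i> * v * u' a / (u a - v)\<^sup>2)) (at a)" for a
    unfolding has_real_derivative_iff_has_vector_derivative h_def
    by (rule bounded_linear.has_vector_derivative[OF bounded_linear_Re Hd])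
  have Im0: "Im (- 2 * \<i> * v * u' a / (u a - v)\<^sup>2) = 0" for a
  proof -
    have "((\<lambda>x. Im (H x)) has_vector_derivative Im (- 2 * \<i> * v * u' a / (u a - v)\<^sup>2)) (at a)"
      by (rule bounded_linear.has_vector_derivative[OF bounded_linear_Im Hd])
    then have "((\<lambda>x. 0) has_vector_derivative Im (- 2 * \<i> * v * u' a / (u a - v)\<^sup>2)) (at a)"
      by (simp only: real)
    then show ?thesis using has_vector_derivative_const vector_derivative_unique_at by blast
  qed
  have "continuous_on {0..2 * pi} h"
    using hd by (meson DERIV_continuous continuous_at_imp_continuous_on)
  then obtain m where m: "\<And>x. x \<in> {0..2 * pi} \<Longrightarrow> h x \<le> h m"
    using continuous_attains_sup[of "{0..2 * pi}" h] by (metis atLeastatMost_empty_iff compact_Icc pi_ge_zero mult_nonneg_nonneg zero_le_numeral)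
  \<comment> \<open>By periodicity the maximum over one turn is global, so it is a critical point
    even at an end of the interval.\<close>
  have max: "h x \<le> h m" for x
  proof -
    obtain y where y: "y \<in> {0..2 * pi}" "cis y = cis x"
      using Arg2pi_ge_0[of "cis x"] Arg2pi_lt_2pi[of "cis x"] Arg2pi_eq[of "cis x"]
      by (intro that[of "Arg2pi (cis x)"]) (auto simp: cis_conv_exp)
    then have "h y = h x" by (simp add: h_def H_def u_def)
    then show ?thesis using m[OF y(1)] by simp
  qed
  have "Re (- 2 * \<i> * v * u' m / (u m - v)\<^sup>2) = 0"
    using DERIV_local_max[OF hd[of m], of 1] max by auto
  then have "- 2 * \<i> * v * u' m / (u m - v)\<^sup>2 = 0" using Im0[of m] by (simp only: complex_eq_iff) simp
  then show False using v0[of m] vertex_prod_deriv_nz[of m] by (simp add: u'_def)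
qed

text \<open>The derivative of \<open>vertex_sum (cis x)\<close> is computed termwise and through the
  affine relation; the common factor \<open>i / tlen z\<close> cancels.\<close>

lemma weighted_vertex_sum:
  assumes aff: "\<And>z. cmod z = 1 \<Longrightarrow> vertex_sum z = \<alpha> + \<beta> * vertex_prod z" and z: "cmod z = 1"
  shows "(\<Sum>i<period. orb z i * tlen (orb z i)) = \<beta> * vertex_prod z * len_sum z"
proof -
  define a where "a = Arg z"
  have a: "cis a = z" using z using cis_Arg[of z] by (cases "z = 0") (auto simp: a_def sgn_eq)
  have "((\<lambda>x. vertex_sum (cis x)) has_vector_derivative
      \<beta> * (\<i> * vertex_prod (cis a) * (len_sum (cis a) / tlen (cis a)))) (at a)"
    using has_vector_derivative_add[OF has_vector_derivative_const
        has_vector_derivative_mult_right[OF vertex_prod_deriv[of a], of \<beta>], of \<alpha>]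
    by (simp add: aff)
  then have "\<i> * (\<Sum>i<period. orb z i * tlen (orb z i)) * (1 / tlen z)
      = \<beta> * (\<i> * vertex_prod z * (len_sum z / tlen z))"
    using vertex_sum_deriv[of a] vector_derivative_unique_at unfolding a by blast
  then show ?thesis using tlen_pos[OF z] by (simp add: field_simps)
qed

section \<open>Area and moment sums over a closed orbit\<close>

lemma sum_orbit_blocks:
  fixes f :: "complex \<Rightarrow> 'a::real_vector"
  assumes "cmod z = 1"
  shows "(\<Sum>i<period * r. f (orb z i)) = real r *\<^sub>R (\<Sum>i<period. f (orb z i))"
proof (induction r)
  case (Suc r)
  have "(\<Sum>i<period * r + k. f (orb z i))
      = (\<Sum>i<period * r. f (orb z i)) + (\<Sum>i<k. f (orb z (period * r + i)))" for k
    by (induction k) (auto simp: add.assoc)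
  moreover have "orb z (period * r + i) = orb z i" for i
    unfolding add.commute[of _ i] funpow_add comp_apply
    using funpow_fixed_mult[OF period(2)[OF assms]] by simp
  ultimately show ?case using Suc by (simp add: algebra_simps)
qed simp

text \<open>This is twice the area of the triangle from 0 to the side: its height is 1, and the
  contact point divides its base into the two tangent lengths.\<close>

lemma side_cross:
  assumes "cmod z = 1"
  shows "Im (cnj (phi z) * phi (step z)) = tlen z + tlen (step z)"
proof -
  have "cnj (foot z) * foot z = 1" using unit_mult_cnj foot_norm assms by blast
  then have "cnj (phi z) * phi (step z) = (1 + \<i> * tlen z) * (1 + \<i> * tlen (step z))"
    unfolding phi_foot[of z] phi_step[OF assms] by simp
  then show ?thesis by simp
qed

text \<open>Trades the weights of sides for weights \<open>tlen\<close> of single vertices, up to a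
  difference that telescopes around the polygon.\<close>

lemma side_moment:
  assumes "cmod z = 1"
  shows "of_real (tlen z + tlen (step z)) * (phi z + phi (step z))
    = tlen z * phi z + tlen (step z) * phi (step z) - \<i> * (phi (step z) - phi z)"
  unfolding phi_foot[of z] phi_step[OF assms] by (simp add: algebra_simps power2_eq_square)

lemma sum_orbit_shift:
  fixes f :: "complex \<Rightarrow> 'a::ab_group_add"
  assumes "cmod z = 1"
  shows "(\<Sum>i<n. f (orb z (Suc i))) = (\<Sum>i<n. f (orb z i))"
  using sum.lessThan_Suc_shift[of "\<lambda>i. f (orb z i)" n] sum.lessThan_Suc[of "\<lambda>i. f (orb z i)" n]
    closed[OF assms] by simp

definition cross :: "complex \<Rightarrow> nat \<Rightarrow> real" where
  "cross z i = Im (cnj (phi (orb z i)) * phi (orb z (Suc i)))"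

lemma cross_eq: "cmod z = 1 \<Longrightarrow> cross z i = tlen (orb z i) + tlen (orb z (Suc i))"
  using side_cross[OF norm_step_funpow, of z i] by (simp add: cross_def)

lemma cross_sum:
  assumes "cmod z = 1"
  shows "(\<Sum>i<n. cross z i) = 2 * (\<Sum>i<n. tlen (orb z i))" "(\<Sum>i<n. cross z i) > 0"
proof -
  show eq: "(\<Sum>i<n. cross z i) = 2 * (\<Sum>i<n. tlen (orb z i))"
    using sum_orbit_shift[OF assms, of tlen] by (simp add: cross_eq[OF assms] sum.distrib)
  show "(\<Sum>i<n. cross z i) > 0"
    unfolding eq using n_pos tlen_pos[OF norm_step_funpow[OF assms]] by (auto intro!: sum_pos)
qed

lemma orbit_sum:
  assumes aff: "\<And>z. cmod z = 1 \<Longrightarrow> vertex_sum z = \<alpha> + \<beta> * vertex_prod z" and z: "cmod z = 1"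
  shows "(\<Sum>i<n. orb z i) = of_nat n * ((\<alpha> + \<beta> * vertex_prod z) / of_nat period)"
proof -
  obtain r where r: "n = period * r" using period_dvd by auto
  have "(\<Sum>i<n. orb z i) = of_nat r * vertex_sum z"
    using sum_orbit_blocks[OF z, of "\<lambda>x. x" r] by (simp add: r vertex_sum_def scaleR_conv_of_real)
  then show ?thesis using aff[OF z] period(1) by (simp add: r)
qed

text \<open>Every vertex belongs to two sides, hence twice the sum weighted by \<open>tlen\<close>
  remains. As \<open>phi\<close> is real affine and the weights are real, the weighted mean passes
  through \<open>phi\<close>.\<close>

lemma orbit_moment:
  assumes aff: "\<And>z. cmod z = 1 \<Longrightarrow> vertex_sum z = \<alpha> + \<beta> * vertex_prod z" and z: "cmod z = 1"
  shows "(\<Sum>i<n. of_real (cross z i) * (phi (orb z i) + phi (orb z (Suc i))))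
    = of_real (\<Sum>i<n. cross z i) * phi (\<beta> * vertex_prod z)"
proof -
  define L where "L = (\<Sum>i<n. tlen (orb z i))"
  have "(\<Sum>i<n. of_real (cross z i) * (phi (orb z i) + phi (orb z (Suc i))))
     = (\<Sum>i<n. tlen (orb z i) * phi (orb z i)) + (\<Sum>i<n. tlen (orb z (Suc i)) * phi (orb z (Suc i)))
       - \<i> * ((\<Sum>i<n. phi (orb z (Suc i))) - (\<Sum>i<n. phi (orb z i)))"
    unfolding cross_eq[OF z] sum_subtractf[symmetric] sum_distrib_left sum.distrib[symmetric]
    using side_moment[OF norm_step_funpow[OF z]] by (intro sum.cong) auto
  also have "\<dots> = 2 * (\<Sum>i<n. tlen (orb z i) * phi (orb z i))"
    using sum_orbit_shift[OF z, of "\<lambda>x. tlen x * phi x"] sum_orbit_shift[OF z, of phi] by simp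
  also have "(\<Sum>i<n. tlen (orb z i) * phi (orb z i)) = of_real L * phi (\<beta> * vertex_prod z)"
  proof -
    obtain r where r: "n = period * r" using period_dvd by auto
    have tz: "(\<Sum>i<n. orb z i * tlen (orb z i)) = of_real L * (\<beta> * vertex_prod z)"
      using sum_orbit_blocks[OF z, of "\<lambda>x. x * tlen x" r] sum_orbit_blocks[OF z, of tlen r]
        weighted_vertex_sum[OF aff z]
      by (simp add: r L_def len_sum_def scaleR_conv_of_real)
    have "(\<Sum>i<n. tlen (orb z i) * phi (orb z i)) = of_real L * c
        + p * (\<Sum>i<n. orb z i * tlen (orb z i)) + q * cnj (\<Sum>i<n. orb z i * tlen (orb z i))"
      by (simp add: phi_def L_def sum_distrib_left sum_distrib_right sum.distrib algebra_simps)
    then show ?thesis unfolding tz by (simp add: phi_def algebra_simps)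
  qed
  finally show ?thesis unfolding cross_sum(1)[OF z] L_def by simp
qed

end

section \<open>Affine maps and ellipses\<close>

definition affmap :: "real \<Rightarrow> real \<Rightarrow> real \<Rightarrow> real \<Rightarrow> real \<Rightarrow> real \<Rightarrow> complex \<Rightarrow> pt" where
  "affmap c1 c2 a b c d z = (c1 + a * Re z + b * Im z, c2 + c * Re z + d * Im z)"

lemma ellipse_affmap:
  assumes "ellipse E"
  obtains c1 c2 a b c d where "a * d - b * c \<noteq> 0" "E = affmap c1 c2 a b c d ` sphere 0 1"
proof -
  obtain c1 c2 a b c d where *: "a * d - b * c \<noteq> 0"
    "E = {(c1 + a * cos t + b * sin t, c2 + c * cos t + d * sin t) | t. True}"
    using assms unfolding ellipse_def by blast
  have "E = affmap c1 c2 a b c d ` range cis"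
    unfolding *(2) by (auto simp: affmap_def image_iff) 
  also have "range cis = sphere 0 1"
  proof -
    have "z \<in> range cis" if "cmod z = 1" for z
      using cis_Arg[of z] that by (cases "z = 0") (auto simp: sgn_eq intro!: range_eqI[of _ _ "Arg z"])
    then show ?thesis by auto
  qed
  finally show ?thesis using that *(1) by blast
qed

lemma affmap_inj:
  assumes "a * d - b * c \<noteq> 0" "affmap c1 c2 a b c d z = affmap c1 c2 a b c d w" shows "z = w"
proof -
  have "a * (Re z - Re w) + b * (Im z - Im w) = 0" "c * (Re z - Re w) + d * (Im z - Im w) = 0"
    using assms(2) by (auto simp: affmap_def algebra_simps)
  then have "(a * d - b * c) * (Re z - Re w) = 0" "(a * d - b * c) * (Im z - Im w) = 0" by algebra+
  then show ?thesis using assms(1) by (auto simp: complex_eq_iff)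
qed

lemma affmap_line:
  "affmap c1 c2 a b c d z + t *\<^sub>R (affmap c1 c2 a b c d w - affmap c1 c2 a b c d z)
   = affmap c1 c2 a b c d (z + of_real t * (w - z))"
  by (simp add: affmap_def algebra_simps)

lemma affmap_factor:
  fixes a b c d a' b' c' d' :: real
  assumes det: "a * d - b * c \<noteq> 0" and det': "a' * d' - b' * c' \<noteq> 0"
  shows "\<exists>k p q. cmod p \<noteq> cmod q \<and>
    (\<forall>z. affmap c1 c2 a b c d (k + p * z + q * cnj z) = affmap k1 k2 a' b' c' d' z)"
proof -
  define D where "D = a * d - b * c"
  define s where "s x y = Complex ((d * x - b * y) / D) ((a * y - c * x) / D)" for x y
  have D: "D \<noteq> 0" using det by (simp add: D_def)
  have s: "a * Re (s x y) + b * Im (s x y) = x" "c * Re (s x y) + d * Im (s x y) = y" for x y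
  proof -
    have "a * Re (s x y) + b * Im (s x y) = (D * x) / D" "c * Re (s x y) + d * Im (s x y) = (D * y) / D"
      by (simp_all add: s_def D_def add_divide_distrib[symmetric] algebra_simps)
    then show "a * Re (s x y) + b * Im (s x y) = x" "c * Re (s x y) + d * Im (s x y) = y" using D by simp_all
  qed
  define k where "k = s (k1 - c1) (k2 - c2)"
  define \<alpha> where "\<alpha> = s a' c'"
  define \<beta> where "\<beta> = s b' d'"
  \<comment> \<open>Writes the real linear map \<open>Re z * \<alpha> + Im z * \<beta>\<close> in
    \<open>z\<close> and \<open>cnj z\<close>; then \<open>(cmod p)^2 - (cmod q)^2\<close> is its
    determinant.\<close>
  define p where "p = (\<alpha> - \<i> * \<beta>) / 2"
  define q where "q = (\<alpha> + \<i> * \<beta>) / 2"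
  have "cmod p \<noteq> cmod q"
  proof
    assume "cmod p = cmod q"
    then have "(cmod p)\<^sup>2 = (cmod q)\<^sup>2" by simp
    moreover have "(cmod p)\<^sup>2 = ((Re \<alpha> + Im \<beta>)\<^sup>2 + (Im \<alpha> - Re \<beta>)\<^sup>2) / 4"
      "(cmod q)\<^sup>2 = ((Re \<alpha> - Im \<beta>)\<^sup>2 + (Im \<alpha> + Re \<beta>)\<^sup>2) / 4"
      unfolding cmod_power2 p_def q_def by (simp_all add: field_simps power2_eq_square)
    ultimately have "Re \<alpha> * Im \<beta> = Im \<alpha> * Re \<beta>"
      by (simp add: algebra_simps power2_eq_square)
    then have "a' * d' = b' * c'"
      using s[of a' c'] s[of b' d'] unfolding \<alpha>_def[symmetric] \<beta>_def[symmetric] by algebra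
    then show False using det' by simp
  qed
  moreover have "affmap c1 c2 a b c d (k + p * z + q * cnj z) = affmap k1 k2 a' b' c' d' z" for z
  proof -
    have e: "k + p * z + q * cnj z = k + of_real (Re z) * \<alpha> + of_real (Im z) * \<beta>"
      by (simp add: p_def q_def complex_eq_iff field_simps)
    have "c1 + (a * Re k + b * Im k) + Re z * (a * Re \<alpha> + b * Im \<alpha>) + Im z * (a * Re \<beta> + b * Im \<beta>)
        = k1 + a' * Re z + b' * Im z"
      "c2 + (c * Re k + d * Im k) + Re z * (c * Re \<alpha> + d * Im \<alpha>) + Im z * (c * Re \<beta> + d * Im \<beta>)
        = k2 + c' * Re z + d' * Im z"
      unfolding k_def \<alpha>_def \<beta>_def s by (simp_all add: algebra_simps)
    then show ?thesis unfolding e affmap_def by (simp add: algebra_simps)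
  qed
  ultimately show ?thesis by blast
qed

text \<open>The hull lies in the image of the closed disc, and the preimage of its interior is open,
  hence contained in the open disc.\<close>

lemma interior_hull_affmap:
  assumes det: "a * d - b * c \<noteq> 0"
    and x: "x \<in> interior (convex hull (affmap c1 c2 a b c d ` sphere 0 1))"
  shows "\<exists>y. cmod y < 1 \<and> x = affmap c1 c2 a b c d y"
proof -
  let ?f = "affmap c1 c2 a b c d"
  have "convex (?f ` cball 0 1)"
    unfolding convex_alt
  proof (intro ballI allI impI)
    fix Y Z :: pt and u :: real
    assume "Y \<in> ?f ` cball 0 1" "Z \<in> ?f ` cball 0 1" "0 \<le> u \<and> u \<le> 1"
    then obtain y z where *: "y \<in> cball 0 1" "z \<in> cball 0 1" "0 \<le> u" "u \<le> 1" "Y = ?f y" "Z = ?f z"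
      by blast
    have "(1 - u) *\<^sub>R ?f y + u *\<^sub>R ?f z = ?f ((1 - u) *\<^sub>R y + u *\<^sub>R z)"
      by (simp add: affmap_def algebra_simps)
    moreover have "(1 - u) *\<^sub>R y + u *\<^sub>R z \<in> cball 0 1"
      using convex_cball[of 0 "1::real"] * unfolding convex_alt by blast
    ultimately show "(1 - u) *\<^sub>R Y + u *\<^sub>R Z \<in> ?f ` cball 0 1" using *(5,6) by simp
  qed
  then have hull: "convex hull (?f ` sphere 0 1) \<subseteq> ?f ` cball 0 1"
    by (intro hull_minimal) auto
  define U where "U = ?f -` interior (convex hull (?f ` sphere 0 1))"
  have "continuous_on UNIV ?f" unfolding affmap_def by (intro continuous_intros)
  then have "open U" unfolding U_def by (intro open_vimage) auto
  moreover have "U \<subseteq> cball 0 1"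
  proof
    fix y assume "y \<in> U"
    then have "?f y \<in> ?f ` cball 0 1" using hull interior_subset unfolding U_def by blast
    then show "y \<in> cball 0 1" using affmap_inj[OF det] by blast
  qed
  ultimately have "U \<subseteq> ball 0 1" by (metis interior_cball interior_maximal)
  moreover obtain y where "x = ?f y" using x hull interior_subset by blast
  moreover have "y \<in> U" using x calculation(2) by (simp add: U_def)
  ultimately have "cmod y < 1 \<and> x = ?f y" by auto
  then show ?thesis by blast
qed

section \<open>Centroids in affine coordinates\<close>

lemma sum_cyclic_shift:
  fixes h :: "nat \<Rightarrow> 'a::ab_group_add"
  shows "(\<Sum>i<n. h (Suc i mod n) - h i) = 0"
proof (cases n)
  case (Suc m)
  have "(\<Sum>i<n. h (Suc i mod n)) = (\<Sum>i<m. h (Suc i)) + h 0" by (simp add: Suc)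
  also have "\<dots> = (\<Sum>i<n. h i)" unfolding Suc sum.lessThan_Suc_shift by simp
  finally show ?thesis by (simp add: sum_subtractf)
qed simp

lemma CM0_affmap:
  assumes "n > 0" "\<And>i. i < n \<Longrightarrow> A i = affmap c1 c2 a b c d (B i)"
  shows "CM0 n A = affmap c1 c2 a b c d ((\<Sum>i<n. B i) / of_nat n)"
proof -
  have "(\<Sum>i<n. A i) = (\<Sum>i<n. affmap c1 c2 a b c d (B i))" using assms by (intro sum.cong) auto
  also have "\<dots> = (real n * c1 + a * Re (\<Sum>i<n. B i) + b * Im (\<Sum>i<n. B i),
      real n * c2 + c * Re (\<Sum>i<n. B i) + d * Im (\<Sum>i<n. B i))"
    by (simp add: affmap_def sum_prod sum.distrib sum_distrib_left)
  finally show ?thesis using assms(1)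
    by (simp add: CM0_def affmap_def field_simps)
qed

text \<open>Affine equivariance of the lamina centroid, which is \<open>w / 3\<close> in the source
  coordinates by \<open>moment\<close>. Each \<open>dd\<close> is the determinant times
  \<open>X\<close> plus a contribution \<open>e\<close> of the translation, the cross product of
  \<open>(c1, c2)\<close> with the linear part, and this contribution telescopes.\<close>

lemma CM2_affmap:
  fixes B :: "nat \<Rightarrow> complex" and a b c d c1 c2 :: real and n :: nat
  defines "X \<equiv> \<lambda>i. Im (cnj (B i) * B (Suc i mod n))"
  assumes n: "n > 0" and A: "\<And>i. i < n \<Longrightarrow> A i = affmap c1 c2 a b c d (B i)"
    and det: "a * d - b * c \<noteq> 0" and area: "(\<Sum>i<n. X i) \<noteq> 0"
    and moment: "(\<Sum>i<n. of_real (X i) * (B i + B (Suc i mod n))) = of_real (\<Sum>i<n. X i) * w"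
  shows "CM2 n A = affmap c1 c2 a b c d (w / 3)"
proof -
  define D S where "D = a * d - b * c" and "S = (\<Sum>i<n. X i)"
  define l k where "l z = a * Re z + b * Im z" and "k z = c * Re z + d * Im z" for z
  define e where "e z = c1 * k z - c2 * l z" for z
  define j where "j i = Suc i mod n" for i
  have Aj: "A (j i) = affmap c1 c2 a b c d (B (j i))" for i using n by (intro A) (simp add: j_def)
  have dd: "dd n A i = D * X i + (e (B (j i)) - e (B i))" if "i < n" for i
    unfolding dd_def j_def[symmetric] Aj A[OF that]
    by (simp add: affmap_def D_def X_def j_def e_def k_def l_def) algebra
  have tele: "(\<Sum>i<n. h (B (j i)) - h (B i)) = 0" for h :: "complex \<Rightarrow> real"
    unfolding j_def using sum_cyclic_shift[of "\<lambda>i. h (B i)" n] .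
  have ddsum: "(\<Sum>i<n. dd n A i) = D * S"
    using tele[of e] by (simp add: dd sum.distrib S_def sum_distrib_left)
  then have area': "signed_area n A = D * S / 2" by (simp add: signed_area_def)
  have R: "(\<Sum>i<n. X i * (Re (B i) + Re (B (j i)))) = S * Re w"
    using arg_cong[OF moment, of Re] by (simp add: j_def S_def)
  have I: "(\<Sum>i<n. X i * (Im (B i) + Im (B (j i)))) = S * Im w"
    using arg_cong[OF moment, of Im] by (simp add: j_def S_def)
  have lin: "(\<Sum>i<n. X i * (x * Re (B i) + y * Im (B i) + (x * Re (B (j i)) + y * Im (B (j i)))))
      = S * (x * Re w + y * Im w)" for x y
  proof -
    have "(\<Sum>i<n. X i * (x * Re (B i) + y * Im (B i) + (x * Re (B (j i)) + y * Im (B (j i)))))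
      = x * (\<Sum>i<n. X i * (Re (B i) + Re (B (j i)))) + y * (\<Sum>i<n. X i * (Im (B i) + Im (B (j i))))"
      unfolding sum_distrib_left sum.distrib[symmetric] by (intro sum.cong) (auto simp: algebra_simps)
    then show ?thesis unfolding R I by (simp add: algebra_simps)
  qed
  \<comment> \<open>The mixed products \<open>e (B (j i)) * l (B i) - e (B i) * l (B (j i))\<close>
    equal \<open>c1 * D * X i\<close>, which raises the coefficient from 2 to 3; the rest
    telescopes.\<close>
  have 1: "dd n A i * (fst (A i) + fst (A (j i))) = D * (X i * (l (B i) + l (B (j i)))) + 3 * c1 * D * X i
     + ((2 * c1 * e (B (j i)) + e (B (j i)) * l (B (j i))) - (2 * c1 * e (B i) + e (B i) * l (B i)))"
    if "i < n" for i
    unfolding dd[OF that] Aj A[OF that]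
    by (simp add: affmap_def D_def X_def j_def e_def k_def l_def) algebra
  have 2: "dd n A i * (snd (A i) + snd (A (j i))) = D * (X i * (k (B i) + k (B (j i)))) + 3 * c2 * D * X i
     + ((2 * c2 * e (B (j i)) + e (B (j i)) * k (B (j i))) - (2 * c2 * e (B i) + e (B i) * k (B i)))"
    if "i < n" for i
    unfolding dd[OF that] Aj A[OF that]
    by (simp add: affmap_def D_def X_def j_def e_def k_def l_def) algebra
  have s1: "(\<Sum>i<n. dd n A i * (fst (A i) + fst (A (j i)))) = D * (S * l w) + 3 * c1 * D * S"
    using tele[of "\<lambda>z. 2 * c1 * e z + e z * l z"] lin[of a b]
    by (simp add: 1 sum.distrib S_def sum_distrib_left[symmetric] l_def)
  have s2: "(\<Sum>i<n. dd n A i * (snd (A i) + snd (A (j i)))) = D * (S * k w) + 3 * c2 * D * S"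
    using tele[of "\<lambda>z. 2 * c2 * e z + e z * k z"] lin[of c d]
    by (simp add: 2 sum.distrib S_def sum_distrib_left[symmetric] k_def)
  have "(\<Sum>i<n. dd n A i *\<^sub>R (A i + A (j i))) = (D * S) *\<^sub>R (l w + 3 * c1, k w + 3 * c2)"
    by (rule prod_eqI) (simp_all add: fst_sum snd_sum s1 s2, simp_all add: algebra_simps)
  then have "CM2 n A = (1 / (6 * (D * S / 2)) * (D * S)) *\<^sub>R (l w + 3 * c1, k w + 3 * c2)"
    unfolding CM2_def area' j_def by simp
  also have "1 / (6 * (D * S / 2)) * (D * S) = 1 / 3"
    using det area by (simp add: D_def S_def)
  finally show ?thesis by (simp add: affmap_def l_def k_def field_simps)
qed

text \<open>The argument of \<open>\<mu>\<close> merely rotates the parameter circle;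
  \<open>s * cmod \<mu>\<close> is the ratio of the homothety, and \<open>\<mu> = 0\<close> gives
  the point.\<close>

lemma affine_image_homothetic_or_point:
  fixes s :: real
  assumes "s > 0" and E: "E = {v + s *\<^sub>R affmap c1 c2 a b c d (\<kappa> + \<mu> * u) | u. cmod u = 1}"
  shows "homothetic_to E (affmap c1 c2 a b c d ` sphere 0 1) \<or> (\<exists>x. E = {x})"
proof (cases "\<mu> = 0")
  case True
  have "\<exists>u::complex. cmod u = 1" by (rule exI[of _ 1]) simp
  then show ?thesis unfolding E by (auto simp: True)
next
  case False
  let ?f = "affmap c1 c2 a b c d"
  define r where "r = s * cmod \<mu>"
  define y where "y = v + s *\<^sub>R ?f \<kappa> - r *\<^sub>R ?f 0"
  have eq: "v + s *\<^sub>R ?f (\<kappa> + \<mu> * u) = r *\<^sub>R ?f (sgn \<mu> * u) + y" for u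
  proof -
    have "\<mu> * u = of_real (cmod \<mu>) * (sgn \<mu> * u)" using False by (simp add: sgn_eq)
    then show ?thesis
      by (simp add: prod_eq_iff affmap_def y_def r_def algebra_simps)
  qed
  have "E = (\<lambda>z. r *\<^sub>R z + y) ` ?f ` sphere 0 1"
  proof (intro equalityI subsetI)
    fix x assume "x \<in> E"
    then obtain u where u: "cmod u = 1" "x = r *\<^sub>R ?f (sgn \<mu> * u) + y" unfolding E eq by blast
    moreover have "sgn \<mu> * u \<in> sphere 0 1" using u False by (simp add: norm_mult norm_sgn)
    ultimately show "x \<in> (\<lambda>z. r *\<^sub>R z + y) ` ?f ` sphere 0 1" by blast
  next
    fix x assume "x \<in> (\<lambda>z. r *\<^sub>R z + y) ` ?f ` sphere 0 1"
    then obtain u where u: "cmod u = 1" "x = r *\<^sub>R ?f u + y" by auto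
    have sg: "cmod (sgn \<mu>) = 1" "sgn \<mu> \<noteq> 0" using False by (auto simp: norm_sgn sgn_zero_iff)
    have "x = r *\<^sub>R ?f (sgn \<mu> * (u / sgn \<mu>)) + y" "cmod (u / sgn \<mu>) = 1"
      using u sg by (simp_all add: norm_divide)
    then show "x \<in> E" unfolding E eq by blast
  qed
  moreover have "r > 0" using False assms(1) by (simp add: r_def)
  ultimately show ?thesis unfolding homothetic_to_def by blast
qed

lemma line_through_commute: "line_through x y = line_through y x"
proof -
  have "line_through x y \<subseteq> line_through y x" for x y
  proof
    fix z assume "z \<in> line_through x y"
    then obtain t where "z = x + t *\<^sub>R (y - x)" by (auto simp: line_through_def)
    then have "z = y + (1 - t) *\<^sub>R (x - y)" by (simp add: algebra_simps)
    then show "z \<in> line_through y x" by (auto simp: line_through_def)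
  qed
  then show ?thesis by blast
qed

section \<open>The loci of the centroids\<close>

context poncelet_pair begin

text \<open>Tangency means a single common point. Reflecting the common point \<open>S\<close> in
  the foot of the perpendicular from 0 to the line gives a common point again, so it is fixed and
  the line is perpendicular to \<open>S\<close>.\<close>

lemma tangent_chord_cases:
  assumes inj: "\<And>x y. f x = f y \<Longrightarrow> x = y"
    and line: "\<And>x y t. f x + t *\<^sub>R (f y - f x) = f (x + of_real t * (y - x))"
    and z: "cmod z = 1" and w: "cmod w = 1" and ne: "z \<noteq> w"
    and tan: "tangent_to (line_through (f (phi z)) (f (phi w))) (f ` sphere 0 1)"
  shows "w = step z \<or> z = step w"
proof -
  define v where "v = phi w - phi z"
  have v: "v \<noteq> 0" using phi_inj ne by (auto simp: v_def)
  have L: "line_through (f (phi z)) (f (phi w)) = {f (phi z + of_real t * v) | t. True}"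
    by (simp add: line_through_def line v_def)
  obtain X where X: "X \<in> line_through (f (phi z)) (f (phi w))" "X \<in> f ` sphere 0 1"
    and uniq: "\<And>Y. Y \<in> line_through (f (phi z)) (f (phi w)) \<Longrightarrow> Y \<in> f ` sphere 0 1 \<Longrightarrow> Y = X"
    using tan unfolding tangent_to_def by blast
  obtain S where S: "cmod S = 1" "X = f S" using X(2) by auto
  obtain t where t: "S = phi z + of_real t * v" using X(1) S(2) inj unfolding L by blast
  define r where "r = Re (S * cnj v)"
  define s where "s = - 2 * r / (cmod v)\<^sup>2"
  have v2: "(cmod v)\<^sup>2 > 0" using v by simp
  have "(cmod (S + of_real s * v))\<^sup>2 = (cmod S)\<^sup>2 + (2 * s * r + s\<^sup>2 * (cmod v)\<^sup>2)"
    unfolding cmod_power2 r_def by (simp add: power2_eq_square algebra_simps)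
  also have "2 * s * r + s\<^sup>2 * (cmod v)\<^sup>2 = s * (2 * r + s * (cmod v)\<^sup>2)"
    by (simp add: power2_eq_square algebra_simps)
  also have "s * (cmod v)\<^sup>2 = - 2 * r" using v2 by (simp add: s_def)
  finally have "(cmod (S + of_real s * v))\<^sup>2 = 1" using S by simp
  then have "cmod (S + of_real s * v) = 1" by (simp add: power2_eq_1_iff) (smt (verit) norm_ge_zero)
  then have "f (S + of_real s * v) \<in> f ` sphere 0 1" by simp
  moreover have "S + of_real s * v = phi z + of_real (t + s) * v" unfolding t by (simp add: algebra_simps)
  then have "f (S + of_real s * v) \<in> line_through (f (phi z)) (f (phi w))"
    unfolding L by (intro CollectI exI[of _ "t + s"]) simp
  ultimately have "f (S + of_real s * v) = X" by (intro uniq)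
  then have "of_real s * v = 0" using inj S(2) by fastforce
  then have "r = 0" using v v2 by (simp add: s_def)
  then have "Re (v * cnj S) = 0" by (simp add: r_def algebra_simps)
  define h where "h = Im (v * cnj S)"
  have "v * cnj S = \<i> * h" using \<open>Re (v * cnj S) = 0\<close> by (simp only: complex_eq_iff h_def) simp
  then have vS: "v = S * (\<i> * h)" using unit_mult_cnj[OF S(1)] by algebra
  have "phi z = S - of_real t * v" using t by simp
  then have 1: "phi z = S * (1 + \<i> * of_real (- t * h))" by (simp add: vS algebra_simps)
  have "phi w = S + of_real (1 - t) * v" unfolding t by (simp add: v_def algebra_simps)
  then have 2: "phi w = S * (1 + \<i> * of_real ((1 - t) * h))" by (simp add: vS algebra_simps)
  show ?thesis by (rule tangent_chord_step[OF z w S(1) ne 1 2])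
qed

end

text \<open>A closed polygon of tangent chords turns around the inner conic in one sense: a change of
  sense at a vertex would mean that it backtracks.\<close>

lemma cyclic_orientation:
  fixes z :: "nat \<Rightarrow> 'a"
  assumes inj: "\<And>i j. T (z i) = T (z j) \<Longrightarrow> z i = z j"
    and adj: "\<And>i. z (Suc i) = T (z i) \<or> z i = T (z (Suc i))"
    and turn: "\<And>i. z (Suc (Suc i)) \<noteq> z i"
  shows "(\<forall>i. z (Suc i) = T (z i)) \<or> (\<forall>i. z i = T (z (Suc i)))"
proof -
  have fwd: "z (Suc (Suc i)) = T (z (Suc i))" if "z (Suc i) = T (z i)" for i
    using adj[of "Suc i"] that inj[of i "Suc (Suc i)"] turn[of i] by metis
  have bwd: "z (Suc i) = T (z (Suc (Suc i)))" if "z i = T (z (Suc i))" for i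
    using adj[of "Suc i"] that turn[of i] by metis
  show ?thesis
  proof (cases "z (Suc 0) = T (z 0)")
    case True
    have "z (Suc i) = T (z i)" for i by (induction i) (use True fwd in auto)
    then show ?thesis by blast
  next
    case False
    then have 0: "z 0 = T (z (Suc 0))" using adj by blast
    have "z i = T (z (Suc i))" for i by (induction i) (use 0 bwd in auto)
    then show ?thesis by blast
  qed
qed

theorem theorem1:
  fixes g G :: "pt set" and n :: nat
  assumes "ellipse g" and "ellipse G"
    and "g \<subseteq> interior (convex hull G)"
    and "n \<ge> 3"
    and "\<forall>p\<in>G. \<exists>A. poncelet_ngon g G n A \<and> A 0 = p"
  shows "(homothetic_to {CM0 n A | A. poncelet_ngon g G n A} G \<or>
            (\<exists>q. {CM0 n A | A. poncelet_ngon g G n A} = {q}))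
       \<and> (homothetic_to {CM2 n A | A. poncelet_ngon g G n A} G \<or>
            (\<exists>q. {CM2 n A | A. poncelet_ngon g G n A} = {q}))"
proof -
  obtain c1 c2 a b c d where det: "a * d - b * c \<noteq> 0" and g: "g = affmap c1 c2 a b c d ` sphere 0 1"
    by (rule ellipse_affmap[OF assms(1)])
  obtain k1 k2 a' b' c' d' where det': "a' * d' - b' * c' \<noteq> 0"
    and G: "G = affmap k1 k2 a' b' c' d' ` sphere 0 1"
    by (rule ellipse_affmap[OF assms(2)])
  define f where "f = affmap c1 c2 a b c d"
  define F where "F = affmap k1 k2 a' b' c' d'"
  have f_inj: "x = y" if "f x = f y" for x y using affmap_inj[OF det] that unfolding f_def by blast
  have F_inj: "x = y" if "F x = F y" for x y using affmap_inj[OF det'] that unfolding F_def by blast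
  obtain k p q where pq: "cmod p \<noteq> cmod q" and
    fF0: "\<forall>z. affmap c1 c2 a b c d (k + p * z + q * cnj z) = affmap k1 k2 a' b' c' d' z"
    using affmap_factor[OF det det', of c1 c2 k1 k2] by blast
  have fF: "f (k + p * z + q * cnj z) = F z" for z unfolding f_def F_def using fF0 by blast
  interpret poncelet_pair k p q
  proof
    show "cmod p \<noteq> cmod q" by (fact pq)
    fix S :: complex assume "cmod S = 1"
    then have "f S \<in> interior (convex hull (F ` sphere 0 1))"
      using assms(3) unfolding g G f_def F_def by auto
    then obtain y where "cmod y < 1" "f S = F y"
      using interior_hull_affmap[OF det'] unfolding F_def by blast
    then have "cmod y < 1" "k + p * y + q * cnj y = S" using f_inj fF by metis+
    then show "\<exists>y. cmod y < 1 \<and> k + p * y + q * cnj y = S" by blast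
  qed
  have fF: "f (phi z) = F z" for z unfolding phi_def by (rule fF)
  have n: "n > 0" using assms(4) by simp
  \<comment> \<open>Each polygon is an orbit of \<open>step\<close>, run forwards or backwards. The
    backward index \<open>n - i\<close> equals \<open>n\<close> at \<open>i = 0\<close>, where
    closure returns \<open>z\<close>.\<close>
  have poly_orbit: "\<exists>z. cmod z = 1 \<and> F z = A 0 \<and> (step ^^ n) z = z \<and>
      ((\<forall>i<n. A i = F ((step ^^ i) z)) \<or> (\<forall>i<n. A i = F ((step ^^ (n - i)) z)))"
    if A: "poncelet_ngon g G n A" for A
  proof -
    \<comment> \<open>Lifting the vertices periodically to all indices frees the orientation
      argument from wrap-around.\<close>
    have "\<forall>i. \<exists>z. cmod z = 1 \<and> A (i mod n) = F z"
    proof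
      fix i
      have "A (i mod n) \<in> F ` sphere 0 1" using A n unfolding poncelet_ngon_def G F_def by simp
      then show "\<exists>z. cmod z = 1 \<and> A (i mod n) = F z" by auto
    qed
    then obtain z where z: "\<And>i. cmod (z i) = 1" "\<And>i. A (i mod n) = F (z i)" by metis
    have per: "z i = z j" if "i mod n = j mod n" for i j using z(2) that F_inj by metis
    have nx: "A (Suc (i mod n) mod n) = F (z (Suc i))" for i using z(2)[of "Suc i"] by (simp add: mod_Suc_eq)
    have nxx: "A (Suc (Suc (i mod n)) mod n) = F (z (Suc (Suc i)))" for i
      using z(2)[of "Suc (Suc i)"] by (simp add: mod_Suc_Suc_eq)
    have A': "F (z i) \<noteq> F (z (Suc i))"
      "tangent_to (line_through (F (z i)) (F (z (Suc i)))) g"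
      "line_through (F (z i)) (F (z (Suc i))) \<noteq> line_through (F (z (Suc i))) (F (z (Suc (Suc i))))" for i
    proof -
      have "i mod n < n" using n by simp
      then have "A (i mod n) \<noteq> A (Suc (i mod n) mod n)"
        "tangent_to (line_through (A (i mod n)) (A (Suc (i mod n) mod n))) g"
        "line_through (A (i mod n)) (A (Suc (i mod n) mod n)) \<noteq>
         line_through (A (Suc (i mod n) mod n)) (A (Suc (Suc (i mod n)) mod n))"
        using A unfolding poncelet_ngon_def by blast+
      then show "F (z i) \<noteq> F (z (Suc i))"
        "tangent_to (line_through (F (z i)) (F (z (Suc i)))) g"
        "line_through (F (z i)) (F (z (Suc i))) \<noteq> line_through (F (z (Suc i))) (F (z (Suc (Suc i))))"
        unfolding nx[of i] nxx[of i] z(2)[of i] by blast+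
    qed
    have adj: "z (Suc i) = step (z i) \<or> z i = step (z (Suc i))" for i
    proof (rule tangent_chord_cases[of f, OF f_inj _ z(1) z(1)])
      show "f x + t *\<^sub>R (f y - f x) = f (x + of_real t * (y - x))" for x y t
        unfolding f_def by (rule affmap_line)
      show "z i \<noteq> z (Suc i)" using A'(1)[of i] by auto
      show "tangent_to (line_through (f (phi (z i))) (f (phi (z (Suc i))))) (f ` sphere 0 1)"
        using A'(2)[of i] unfolding fF g f_def[symmetric] .
    qed
    \<comment> \<open>Equal vertices two apart would put consecutive sides on one line.\<close>
    have turn: "z (Suc (Suc i)) \<noteq> z i" for i using A'(3)[of i] line_through_commute by metis
    consider "\<And>i. z (Suc i) = step (z i)" | "\<And>i. z i = step (z (Suc i))"
      using cyclic_orientation[of step z] step_inj z(1) adj turn by metis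
    then show ?thesis
    proof cases
      case 1
      have orb: "z i = (step ^^ i) (z 0)" for i by (induction i) (auto simp: 1)
      have "z n = z 0" by (rule per) simp
      then have "(step ^^ n) (z 0) = z 0" using orb by metis
      moreover have "A i = F ((step ^^ i) (z 0))" if "i < n" for i using z(2)[of i] orb[of i] that by simp
      moreover have "F (z 0) = A 0" using z(2)[of 0] by simp
      ultimately show ?thesis using z(1) by blast
    next
      case 2
      have orb: "z (n - i) = (step ^^ i) (z n)" if "i \<le> n" for i
        using that
      proof (induction i)
        case (Suc i)
        then have "z (n - Suc i) = step (z (n - i))" using 2[of "n - Suc i"] by (simp add: Suc_diff_Suc)
        then show ?case using Suc by simp
      qed simp
      have zn: "z n = z 0" by (rule per) simp
      then have "(step ^^ n) (z 0) = z 0" using orb[of n] by simp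
      moreover have "A i = F ((step ^^ (n - i)) (z 0))" if "i < n" for i
        using z(2)[of i] orb[of "n - i"] that zn by simp
      moreover have "F (z 0) = A 0" using z(2)[of 0] by simp
      ultimately show ?thesis using z(1) by blast
    qed
  qed
  have exA: "\<exists>A. poncelet_ngon g G n A \<and> A 0 = F z" if "cmod z = 1" for z
    using assms(5) that unfolding G F_def by auto
  \<comment> \<open>Every point of the circle is the base point of some closed polygon, so
    \<open>poly_orbit\<close> gives closure everywhere.\<close>
  interpret poncelet_closed k p q n
  proof
    show "n > 0" by (fact n)
    show "(step ^^ n) z = z" if "cmod z = 1" for z
      using exA[OF that] poly_orbit F_inj by metis
  qed
  obtain \<alpha> \<beta> where aff: "\<And>z. cmod z = 1 \<Longrightarrow> vertex_sum z = \<alpha> + \<beta> * vertex_prod z"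
    using vertex_sum_affine by blast
  have CM: "CM0 n A = F ((\<alpha> + \<beta> * vertex_prod z) / of_nat period) \<and>
      CM2 n A = f (phi (\<beta> * vertex_prod z) / 3)"
    if z: "cmod z = 1" and A: "(\<forall>i<n. A i = F (orb z i)) \<or> (\<forall>i<n. A i = F (orb z (n - i)))" for A z
    using A
  proof
    assume A: "\<forall>i<n. A i = F (orb z i)"
    have "CM0 n A = F ((\<Sum>i<n. orb z i) / of_nat n)"
      unfolding F_def by (rule CM0_affmap[OF n]) (use A in \<open>simp add: F_def\<close>)
    moreover have "CM2 n A = f (phi (\<beta> * vertex_prod z) / 3)"
    proof -
      have j: "orb z (Suc i mod n) = orb z (Suc i)" if "i < n" for i
        using closed[OF z] that by (cases "Suc i = n") auto
      have X: "Im (cnj (phi (orb z i)) * phi (orb z (Suc i mod n))) = cross z i" if "i < n" for i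
        by (simp only: j[OF that] cross_def)
      have sumX: "(\<Sum>i<n. Im (cnj (phi (orb z i)) * phi (orb z (Suc i mod n)))) = (\<Sum>i<n. cross z i)"
        by (intro sum.cong) (simp_all only: X lessThan_iff)
      have sumM: "(\<Sum>i<n. of_real (Im (cnj (phi (orb z i)) * phi (orb z (Suc i mod n)))) *
          (phi (orb z i) + phi (orb z (Suc i mod n))))
          = (\<Sum>i<n. of_real (cross z i) * (phi (orb z i) + phi (orb z (Suc i))))"
        by (intro sum.cong) (simp_all only: j cross_def lessThan_iff)
      show ?thesis unfolding f_def
      proof (rule CM2_affmap[OF n _ det, where B = "\<lambda>i. phi (orb z i)"], unfold sumX sumM)
        show "A i = affmap c1 c2 a b c d (phi (orb z i))" if "i < n" for i
          using A fF that unfolding f_def by simp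
        show "(\<Sum>i<n. cross z i) \<noteq> 0" using cross_sum(2)[OF z] by simp
      qed (rule orbit_moment[OF aff z])
    qed
    ultimately show ?thesis using orbit_sum[OF aff z] n by simp
  next
    \<comment> \<open>Reversal keeps the vertex sum and negates both area and moment, so both
      centroids are unchanged.\<close>
    assume A: "\<forall>i<n. A i = F (orb z (n - i))"
    have rev: "(\<Sum>i<n. h (n - Suc i)) = (\<Sum>i<n. h i)" for h :: "nat \<Rightarrow> 'b::comm_monoid_add"
      by (rule sum.nat_diff_reindex)
    have "(\<Sum>i<n. orb z (n - i)) = (\<Sum>i<n. orb z (Suc (n - Suc i)))"
      by (intro sum.cong) (auto simp: Suc_diff_Suc)
    also have "\<dots> = (\<Sum>i<n. orb z i)"
      using rev[of "\<lambda>i. orb z (Suc i)"] sum_orbit_shift[OF z, of "\<lambda>x. x"] by simp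
    finally have "(\<Sum>i<n. orb z (n - i)) = (\<Sum>i<n. orb z i)" .
    moreover have "CM0 n A = F ((\<Sum>i<n. orb z (n - i)) / of_nat n)"
      unfolding F_def by (rule CM0_affmap[OF n]) (use A in \<open>simp add: F_def\<close>)
    ultimately have "CM0 n A = F ((\<Sum>i<n. orb z i) / of_nat n)" by simp
    moreover have "CM2 n A = f (phi (\<beta> * vertex_prod z) / 3)"
    proof -
      define B where "B i = phi (orb z (n - i))" for i
      have B1: "B i = phi (orb z (Suc (n - Suc i)))" if "i < n" for i
        using that by (simp add: B_def Suc_diff_Suc del: funpow.simps)
      have B2: "B (Suc i mod n) = phi (orb z (n - Suc i))" if "i < n" for i
        using closed[OF z] that by (cases "Suc i = n") (auto simp: B_def)
      have X: "Im (cnj (B i) * B (Suc i mod n)) = - cross z (n - Suc i)" if "i < n" for i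
        unfolding B1[OF that] B2[OF that] cross_def by (simp add: algebra_simps del: funpow.simps)
      have sumX: "(\<Sum>i<n. Im (cnj (B i) * B (Suc i mod n))) = - (\<Sum>i<n. cross z i)"
      proof -
        have "(\<Sum>i<n. Im (cnj (B i) * B (Suc i mod n))) = (\<Sum>i<n. - cross z (n - Suc i))"
          by (intro sum.cong) (simp_all only: X lessThan_iff)
        then show ?thesis using rev[of "\<lambda>i. - cross z i"] by (simp add: sum_negf)
      qed
      have sumM: "(\<Sum>i<n. of_real (Im (cnj (B i) * B (Suc i mod n))) * (B i + B (Suc i mod n)))
          = - (\<Sum>i<n. of_real (cross z i) * (phi (orb z i) + phi (orb z (Suc i))))"
      proof -
        have "(\<Sum>i<n. of_real (Im (cnj (B i) * B (Suc i mod n))) * (B i + B (Suc i mod n)))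
          = (\<Sum>i<n. of_real (- cross z (n - Suc i)) * (phi (orb z (Suc (n - Suc i))) + phi (orb z (n - Suc i))))"
        proof (intro sum.cong refl)
          fix i assume "i \<in> {..<n}"
          then have i: "i < n" by simp
          show "of_real (Im (cnj (B i) * B (Suc i mod n))) * (B i + B (Suc i mod n))
            = of_real (- cross z (n - Suc i)) * (phi (orb z (Suc (n - Suc i))) + phi (orb z (n - Suc i)))"
            unfolding X[OF i] unfolding B1[OF i] B2[OF i] ..
        qed
        then show ?thesis
          using rev[of "\<lambda>i. of_real (- cross z i) * (phi (orb z (Suc i)) + phi (orb z i))"]
          by (simp add: sum_negf add.commute del: funpow.simps)
      qed
      show ?thesis unfolding f_def
      proof (rule CM2_affmap[OF n _ det, where B = B], unfold sumX sumM)
        show "A i = affmap c1 c2 a b c d (B i)" if "i < n" for i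
          using A fF that unfolding f_def B_def by simp
        show "- (\<Sum>i<n. cross z i) \<noteq> 0" using cross_sum(2)[OF z] by simp
      qed (simp only: orbit_moment[OF aff z] of_real_minus minus_mult_left)
    qed
    ultimately show ?thesis using orbit_sum[OF aff z] n by simp
  qed
  \<comment> \<open>The locus of a quantity that depends only on the vertex product is parametrised
    by the whole unit circle, because the product has modulus 1 and takes every such value.\<close>
  have loci: "{h A | A. poncelet_ngon g G n A} = {H u | u. cmod u = 1}"
    if h: "\<And>A z. cmod z = 1 \<Longrightarrow> (\<forall>i<n. A i = F (orb z i)) \<or> (\<forall>i<n. A i = F (orb z (n - i)))
        \<Longrightarrow> h A = H (vertex_prod z)" for h :: "(nat \<Rightarrow> pt) \<Rightarrow> pt" and H
  proof (intro equalityI subsetI)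
    fix x assume "x \<in> {h A | A. poncelet_ngon g G n A}"
    then obtain A where A: "poncelet_ngon g G n A" "x = h A" by blast
    then show "x \<in> {H u | u. cmod u = 1}" using poly_orbit[OF A(1)] h norm_vertex_prod by blast
  next
    fix x assume "x \<in> {H u | u. cmod u = 1}"
    then obtain u where u: "cmod u = 1" "x = H u" by blast
    then obtain z where z: "cmod z = 1" "vertex_prod z = u" using vertex_prod_surj by blast
    obtain A where A: "poncelet_ngon g G n A" "A 0 = F z" using exA[OF z(1)] by blast
    obtain z' where z': "cmod z' = 1" "F z' = A 0"
      "(\<forall>i<n. A i = F (orb z' i)) \<or> (\<forall>i<n. A i = F (orb z' (n - i)))"
      using poly_orbit[OF A(1)] by blast
    have "z' = z" using z'(2) A(2) F_inj by simp
    then have "h A = x" using h[OF z'(1,3)] z u by simp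
    then show "x \<in> {h A | A. poncelet_ngon g G n A}" using A(1) by blast
  qed
  have "{CM0 n A | A. poncelet_ngon g G n A} = {F ((\<alpha> + \<beta> * u) / of_nat period) | u. cmod u = 1}"
    by (rule loci) (use CM in blast)
  also have "\<dots> = {0 + 1 *\<^sub>R F (\<alpha> / of_nat period + \<beta> / of_nat period * u) | u. cmod u = 1}"
    by (simp add: add_divide_distrib)
  finally have 0: "{CM0 n A | A. poncelet_ngon g G n A} =
      {0 + 1 *\<^sub>R F (\<alpha> / of_nat period + \<beta> / of_nat period * u) | u. cmod u = 1}" .
  \<comment> \<open>\<open>w / 3\<close> is the combination of 0 and \<open>w\<close> with weights
    2/3 and 1/3, which the affine map \<open>f\<close> preserves.\<close>
  have third: "f (w / 3) = (2 / 3) *\<^sub>R f 0 + (1 / 3) *\<^sub>R f w" for w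
    by (simp add: f_def affmap_def field_simps)
  have "{CM2 n A | A. poncelet_ngon g G n A} = {f (phi (\<beta> * u) / 3) | u. cmod u = 1}"
    by (rule loci) (use CM in blast)
  also have "\<dots> = {(2 / 3) *\<^sub>R f 0 + (1 / 3) *\<^sub>R F (0 + \<beta> * u) | u. cmod u = 1}"
    by (simp only: third fF add_0)
  finally have 2: "{CM2 n A | A. poncelet_ngon g G n A} =
      {(2 / 3) *\<^sub>R f 0 + (1 / 3) *\<^sub>R F (0 + \<beta> * u) | u. cmod u = 1}" .
  show ?thesis
    using affine_image_homothetic_or_point[OF _ 0[unfolded F_def], folded F_def]
      affine_image_homothetic_or_point[OF _ 2[unfolded F_def], folded F_def]
    unfolding G F_def[symmetric] by simp
qed

end
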